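(* Let $\Sigma$ be a (connected) Riemann surface. (i) Let $(g,\nabla)$ and $(\hat g,\hat\nabla)$ be two special Kähler structures on $\Sigma$ whose associated cubic forms are $\Xi$ and $\hat\Xi$ respectively, with $\Xi,\hat\Xi\not\equiv0$. If $g=\hat g$, then $\hat\Xi=\lambda\cdot\Xi$ for some $\lambda\in\mathbb C$ of absolute value $1$. (ii) If $(g,\nabla)$ is a special Kähler structure on $\Sigma$ whose associated cubic form is $\Xi\not\equiv0$, then for each $\lambda\in\mathbb C$ with $|\lambda|=1$ there is a unique special Kähler structure $(g,\nabla_\lambda)$ on $\Sigma$ with the same metric $g$ whose associated cubic form is $\lambda\,\Xi$.
   Context: A special Kähler structure on a Riemann surface with complex structure $I$ is a pair $(g,\nabla)$, where $g$ is a Kähler metric with symplectic form $\omega(\cdot,\cdot)=g(I\cdot,\cdot)$ and $\nabla$ is a flat, torsion-free connection on the tangent bundle with $\nabla\omega=0$ and $(\nabla_XI)Y=(\nabla_YI)X$ for all vector fields $X,Y$. Locally there are holomorphic functions $(Z,W)$ (conjugate special holomorphic coordinates) with $\nabla(\mathrm{Re}\,dZ)=0=\nabla(\mathrm{Re}\,dW)$ and $\omega=-\mathrm{Re}\,dZ\wedge\mathrm{Re}\,dW$. With $\tau=dW/dZ$, the associated cubic form is the holomorphic cubic differential $\Xi=\frac14\frac{d\tau}{dZ}dZ^3$, which does not depend on choices. *)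

theory Defs
  imports "HOL-Analysis.Analysis"
begin

section \<open>Smooth maps\<close>

primrec Ck_on :: "nat \<Rightarrow> 'a set \<Rightarrow> ('a::real_normed_vector \<Rightarrow> 'b::real_normed_vector) \<Rightarrow> bool" where
  "Ck_on 0 S = (\<lambda>f. continuous_on S f)"
| "Ck_on (Suc k) S = (\<lambda>f. (\<forall>z\<in>S. f differentiable (at z)) \<and>
     (\<forall>v. Ck_on k S (\<lambda>z. frechet_derivative f (at z) v)))"

text \<open>This is the usual notion of a smooth map only for open \<open>S\<close>.\<close>

definition smooth_on :: "'a set \<Rightarrow> ('a::real_normed_vector \<Rightarrow> 'b::real_normed_vector) \<Rightarrow> bool" where
  "smooth_on S f \<longleftrightarrow> (\<forall>k. Ck_on k S f)"

section \<open>Riemann surfaces\<close>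

text \<open>
  A chart is a pair of its domain and its coordinate map; the values of the map
  outside the domain are irrelevant. The atlas is not assumed to be maximal:
  every tensor field or connection given over one atlas extends uniquely to the maximal one.
\<close>

type_synonym 'a chart = "'a set \<times> ('a \<Rightarrow> complex)"

definition chart_image :: "'a chart \<Rightarrow> complex set" where
  "chart_image c = snd c ` fst c"

definition overlap :: "'a chart \<Rightarrow> 'a chart \<Rightarrow> complex set" where
  "overlap c d = snd c ` (fst c \<inter> fst d)"

definition transition :: "'a chart \<Rightarrow> 'a chart \<Rightarrow> complex \<Rightarrow> complex" where
  "transition c d = snd d \<circ> inv_into (fst c) (snd c)"

definition chart_on :: "'a topology \<Rightarrow> 'a chart \<Rightarrow> bool" where
  "chart_on X c \<longleftrightarrow> openin X (fst c) \<and> open (chart_image c) \<and>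
     homeomorphic_map (subtopology X (fst c)) (top_of_set (chart_image c)) (snd c)"

text \<open>Second countability is not required; it is automatic by the theorem of Rado.\<close>

definition riemann_surface :: "'a topology \<Rightarrow> 'a chart set \<Rightarrow> bool" where
  "riemann_surface X A \<longleftrightarrow>
     Hausdorff_space X \<and> connected_space X \<and>
     (\<forall>c\<in>A. chart_on X c) \<and> \<Union>(fst ` A) = topspace X \<and>
     (\<forall>c\<in>A. \<forall>d\<in>A. transition c d holomorphic_on overlap c d)"

section \<open>Kaehler metrics\<close>

text \<open>
  Through a chart every tangent space is identified with the real vector space of complex
  numbers, on which \<open>I\<close> is multiplication by the imaginary unit; a change of
  charts acts on it by the complex derivative of the transition map. Fields are families
  of local expressions, indexed by the charts and by the points of the chart images. They are
  set to zero at all other indices, so that two fields coincide iff they are equal as functions.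
\<close>

type_synonym 'a metric = "'a chart \<Rightarrow> complex \<Rightarrow> complex \<Rightarrow> complex \<Rightarrow> real"

text \<open>
  The condition \<open>d\<omega> = 0\<close> is void, because \<open>\<omega>\<close> is a 2-form on a surface.
\<close>

definition kaehler_metric :: "'a chart set \<Rightarrow> 'a metric \<Rightarrow> bool" where
  "kaehler_metric A g \<longleftrightarrow>
     (\<forall>c z u v. c \<notin> A \<or> z \<notin> chart_image c \<longrightarrow> g c z u v = 0) \<and>
     (\<forall>c\<in>A. (\<forall>u v. smooth_on (chart_image c) (\<lambda>z. g c z u v)) \<and>
        (\<forall>z\<in>chart_image c. bilinear (g c z) \<and>
           (\<forall>u v. g c z u v = g c z v u) \<and>
           (\<forall>u. u \<noteq> 0 \<longrightarrow> g c z u u > 0) \<and>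
           (\<forall>u v. g c z (\<i> * u) (\<i> * v) = g c z u v))) \<and>
     (\<forall>c\<in>A. \<forall>d\<in>A. \<forall>z\<in>overlap c d. \<forall>u v.
        g d (transition c d z) (deriv (transition c d) z * u) (deriv (transition c d) z * v)
          = g c z u v)"

definition kaehler_form :: "'a metric \<Rightarrow> 'a metric" where
  "kaehler_form g c z u v = g c z (\<i> * u) v"

section \<open>Connections on the tangent bundle\<close>

text \<open>
  A connection is given in each chart by its Christoffel tensor \<open>\<Gamma>\<close>, the difference between
  the covariant derivative and the directional derivative of the coordinate expressions.
  The compatibility condition says that the covariant derivative of vector fields does
  not depend on the chart.
\<close>

type_synonym 'a connection = "'a chart \<Rightarrow> complex \<Rightarrow> complex \<Rightarrow> complex \<Rightarrow> complex"

type_synonym vfield = "complex \<Rightarrow> complex"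

definition dir_deriv :: "vfield \<Rightarrow> (complex \<Rightarrow> 'b::real_normed_vector) \<Rightarrow> complex \<Rightarrow> 'b" where
  "dir_deriv X f = (\<lambda>z. frechet_derivative f (at z) (X z))"

definition lie_bracket :: "vfield \<Rightarrow> vfield \<Rightarrow> vfield" where
  "lie_bracket X Y = (\<lambda>z. dir_deriv X Y z - dir_deriv Y X z)"

definition cov_deriv :: "'a connection \<Rightarrow> 'a chart \<Rightarrow> vfield \<Rightarrow> vfield \<Rightarrow> vfield" where
  "cov_deriv \<Gamma> c X Y = (\<lambda>z. dir_deriv X Y z + \<Gamma> c z (X z) (Y z))"

definition tangent_connection :: "'a chart set \<Rightarrow> 'a connection \<Rightarrow> bool" where
  "tangent_connection A \<Gamma> \<longleftrightarrow>
     (\<forall>c z u v. c \<notin> A \<or> z \<notin> chart_image c \<longrightarrow> \<Gamma> c z u v = 0) \<and>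
     (\<forall>c\<in>A. (\<forall>u v. smooth_on (chart_image c) (\<lambda>z. \<Gamma> c z u v)) \<and>
        (\<forall>z\<in>chart_image c. bilinear (\<Gamma> c z))) \<and>
     (\<forall>c\<in>A. \<forall>d\<in>A. \<forall>X Y X' Y'.
        smooth_on (overlap c d) X \<and> smooth_on (overlap c d) Y \<and>
        smooth_on (overlap d c) X' \<and> smooth_on (overlap d c) Y' \<and>
        (\<forall>z\<in>overlap c d. X' (transition c d z) = deriv (transition c d) z * X z \<and>
                          Y' (transition c d z) = deriv (transition c d) z * Y z) \<longrightarrow>
        (\<forall>z\<in>overlap c d. cov_deriv \<Gamma> d X' Y' (transition c d z)
                          = deriv (transition c d) z * cov_deriv \<Gamma> c X Y z))"

definition flat_connection :: "'a chart set \<Rightarrow> 'a connection \<Rightarrow> bool" where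
  "flat_connection A \<Gamma> \<longleftrightarrow>
     (\<forall>c\<in>A. \<forall>X Y V. smooth_on (chart_image c) X \<and> smooth_on (chart_image c) Y \<and>
        smooth_on (chart_image c) V \<longrightarrow>
        (\<forall>z\<in>chart_image c.
           cov_deriv \<Gamma> c X (cov_deriv \<Gamma> c Y V) z - cov_deriv \<Gamma> c Y (cov_deriv \<Gamma> c X V) z
             - cov_deriv \<Gamma> c (lie_bracket X Y) V z = 0))"

definition torsion_free :: "'a chart set \<Rightarrow> 'a connection \<Rightarrow> bool" where
  "torsion_free A \<Gamma> \<longleftrightarrow>
     (\<forall>c\<in>A. \<forall>X Y. smooth_on (chart_image c) X \<and> smooth_on (chart_image c) Y \<longrightarrow>
        (\<forall>z\<in>chart_image c.
           cov_deriv \<Gamma> c X Y z - cov_deriv \<Gamma> c Y X z - lie_bracket X Y z = 0))"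

text \<open>\<open>\<nabla>\<omega> = 0\<close>, where \<open>\<omega>\<close> is given by its local expressions\<close>

definition parallel_form2 :: "'a chart set \<Rightarrow> 'a connection \<Rightarrow> 'a metric \<Rightarrow> bool" where
  "parallel_form2 A \<Gamma> \<omega> \<longleftrightarrow>
     (\<forall>c\<in>A. \<forall>X Y V. smooth_on (chart_image c) X \<and> smooth_on (chart_image c) Y \<and>
        smooth_on (chart_image c) V \<longrightarrow>
        (\<forall>z\<in>chart_image c.
           dir_deriv X (\<lambda>w. \<omega> c w (Y w) (V w)) z
             - \<omega> c z (cov_deriv \<Gamma> c X Y z) (V z) - \<omega> c z (Y z) (cov_deriv \<Gamma> c X V z) = 0))"

text \<open>The covariant derivative of the complex structure, \<open>(\<nabla>\<^sub>X I) Y = \<nabla>\<^sub>X (I Y) - I (\<nabla>\<^sub>X Y)\<close>\<close>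

definition cov_deriv_I :: "'a connection \<Rightarrow> 'a chart \<Rightarrow> vfield \<Rightarrow> vfield \<Rightarrow> vfield" where
  "cov_deriv_I \<Gamma> c X Y = (\<lambda>z. cov_deriv \<Gamma> c X (\<lambda>w. \<i> * Y w) z - \<i> * cov_deriv \<Gamma> c X Y z)"

section \<open>Special Kaehler structures\<close>

definition special_kaehler :: "'a chart set \<Rightarrow> 'a metric \<Rightarrow> 'a connection \<Rightarrow> bool" where
  "special_kaehler A g \<Gamma> \<longleftrightarrow>
     kaehler_metric A g \<and> tangent_connection A \<Gamma> \<and>
     flat_connection A \<Gamma> \<and> torsion_free A \<Gamma> \<and> parallel_form2 A \<Gamma> (kaehler_form g) \<and>
     (\<forall>c\<in>A. \<forall>X Y. smooth_on (chart_image c) X \<and> smooth_on (chart_image c) Y \<longrightarrow>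
        (\<forall>z\<in>chart_image c. cov_deriv_I \<Gamma> c X Y z = cov_deriv_I \<Gamma> c Y X z))"

section \<open>The associated cubic form\<close>

text \<open>\<open>Re dZ\<close>, as a real-linear form on the tangent space at \<open>z\<close>\<close>

definition Re_d :: "(complex \<Rightarrow> complex) \<Rightarrow> complex \<Rightarrow> complex \<Rightarrow> real" where
  "Re_d Z z u = Re (deriv Z z * u)"

definition parallel_form1 ::
    "'a connection \<Rightarrow> 'a chart \<Rightarrow> complex set \<Rightarrow> (complex \<Rightarrow> complex \<Rightarrow> real) \<Rightarrow> bool" where
  "parallel_form1 \<Gamma> c V \<alpha> \<longleftrightarrow>
     (\<forall>X Y. smooth_on V X \<and> smooth_on V Y \<longrightarrow>
        (\<forall>z\<in>V. dir_deriv X (\<lambda>w. \<alpha> w (Y w)) z - \<alpha> z (cov_deriv \<Gamma> c X Y z) = 0))"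

text \<open>
  Conjugate special holomorphic coordinates on an open part \<open>V\<close> of the image of the
  chart \<open>c\<close>. The last condition is \<open>\<omega> = - Re dZ \<and> Re dW\<close> and
  forces \<open>dZ\<close> and \<open>dW\<close> to have no zeros.
\<close>

definition conj_special_coords ::
    "'a metric \<Rightarrow> 'a connection \<Rightarrow> 'a chart \<Rightarrow> complex set \<Rightarrow>
      (complex \<Rightarrow> complex) \<Rightarrow> (complex \<Rightarrow> complex) \<Rightarrow> bool" where
  "conj_special_coords g \<Gamma> c V Z W \<longleftrightarrow>
     open V \<and> V \<subseteq> chart_image c \<and> Z holomorphic_on V \<and> W holomorphic_on V \<and>
     parallel_form1 \<Gamma> c V (Re_d Z) \<and> parallel_form1 \<Gamma> c V (Re_d W) \<and>
     (\<forall>z\<in>V. \<forall>u v. kaehler_form g c z u v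
        = - (Re_d Z z u * Re_d W z v - Re_d Z z v * Re_d W z u))"

text \<open>
  The local expression of a cubic differential \<open>\<Xi>\<close> in the chart \<open>c\<close> with coordinate \<open>z\<close>
  is its coefficient with respect to \<open>dz\<^sup>3\<close>. For \<open>\<Xi> = (1/4) (d\<tau>/dZ) dZ\<^sup>3\<close> with \<open>\<tau> = dW/dZ\<close>
  this is \<open>(1/4) (\<tau>'/Z') Z'\<^sup>3\<close>, which does not depend on the conjugate coordinates chosen.
\<close>

type_synonym 'a cubic = "'a chart \<Rightarrow> complex \<Rightarrow> complex"

definition cubic_form :: "'a chart set \<Rightarrow> 'a metric \<Rightarrow> 'a connection \<Rightarrow> 'a cubic" where
  "cubic_form A g \<Gamma> c z =
     (if c \<in> A \<and> z \<in> chart_image c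
      then THE x. \<exists>V Z W. conj_special_coords g \<Gamma> c V Z W \<and> z \<in> V \<and>
             x = 1 / 4 * (deriv (\<lambda>w. deriv W w / deriv Z w) z / deriv Z z) * deriv Z z ^ 3
      else 0)"

end

theory Submission
  imports Defs "HOL-Complex_Analysis.Complex_Analysis"
begin

text \<open>
  In a holomorphic coordinate \<open>z\<close> with \<open>g = \<rho> |dz|\<^sup>2\<close>, the symmetries of the Christoffel tensor
  force \<open>\<Gamma>(u, v) = a u v + b u* v*\<close> (with \<open>*\<close> for conjugation), \<open>\<nabla>\<omega> = 0\<close> gives
  \<open>a = \<partial>(log \<rho>)\<close>, and flatness means \<open>\<partial>a/\<partial>z* = - |b|\<^sup>2\<close> and \<open>\<partial>b/\<partial>z = - a b\<close>. Hence \<open>\<theta> = \<rho> b*\<close> is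
  holomorphic, \<open>\<Xi> = - (\<i>/2) \<theta> dz\<^sup>3\<close>, and \<open>g\<close> determines \<open>a\<close> and \<open>|\<theta>|\<close>. Two cubic forms with
  the same metric therefore have a quotient of modulus 1, which is locally constant, and
  the identity theorem spreads it over the connected surface. Conversely, conjugating \<open>\<nabla>\<close>
  by a constant \<open>\<mu>\<close> with \<open>\<mu>\<^sup>2 = \<lambda>\<close> multiplies \<open>\<Xi>\<close> by \<open>\<lambda>\<close> and keeps \<open>g\<close>.

  The formula for \<open>\<Xi>\<close> needs special coordinates to exist near every point: \<open>F = dZ/dz\<close> has to
  solve \<open>dF = (a F + b* F*) dz\<close>. The solution is the limit of radial Picard iterates, and
  integrability makes the antiholomorphic derivatives of the iterates tend to zero.
\<close>

section \<open>A linear system integrable in the sense of Frobenius\<close>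

text \<open>On an open set, \<open>p\<close> and \<open>q\<close> are the derivatives of f by z and
  by the conjugate of z. They are carried as arguments because the Picard estimates bound the
  antiholomorphic part separately.\<close>

definition wirtinger_C1 ::
    "complex set \<Rightarrow> (complex \<Rightarrow> complex) \<Rightarrow> (complex \<Rightarrow> complex) \<Rightarrow> (complex \<Rightarrow> complex) \<Rightarrow> bool" where
  "wirtinger_C1 S f p q \<longleftrightarrow> continuous_on S p \<and> continuous_on S q \<and>
     (\<forall>z\<in>S. (f has_derivative (\<lambda>u. p z * u + q z * cnj u)) (at z))"

lemma wirtinger_C1_D:
  assumes "wirtinger_C1 S f p q" "z \<in> S"
  shows "(f has_derivative (\<lambda>u. p z * u + q z * cnj u)) (at z)"
  using assms by (auto simp: wirtinger_C1_def)

lemma wirtinger_C1_continuous: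
  assumes "wirtinger_C1 S f p q"
  shows "continuous_on S p" "continuous_on S q" "continuous_on S f"
  using assms unfolding wirtinger_C1_def
  by (auto intro!: continuous_at_imp_continuous_on has_derivative_continuous)

lemma wirtinger_C1_subset: "wirtinger_C1 S f p q \<Longrightarrow> T \<subseteq> S \<Longrightarrow> wirtinger_C1 T f p q"
  unfolding wirtinger_C1_def by (auto intro: continuous_on_subset)

lemma wirtinger_C1_const: "wirtinger_C1 S (\<lambda>z. c) (\<lambda>z. 0) (\<lambda>z. 0)"
  unfolding wirtinger_C1_def by simp

lemma wirtinger_C1_cnj:
  assumes "wirtinger_C1 S f p q"
  shows "wirtinger_C1 S (\<lambda>z. cnj (f z)) (\<lambda>z. cnj (q z)) (\<lambda>z. cnj (p z))"
  using assms unfolding wirtinger_C1_def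
  by (auto intro!: continuous_intros derivative_eq_intros simp: algebra_simps)

lemma wirtinger_C1_add:
  assumes "wirtinger_C1 S f p q" "wirtinger_C1 S f' p' q'"
  shows "wirtinger_C1 S (\<lambda>z. f z + f' z) (\<lambda>z. p z + p' z) (\<lambda>z. q z + q' z)"
  using assms unfolding wirtinger_C1_def
  by (auto intro!: continuous_intros derivative_eq_intros simp: algebra_simps)

lemma wirtinger_C1_mult:
  assumes "wirtinger_C1 S f p q" "wirtinger_C1 S f' p' q'"
  shows "wirtinger_C1 S (\<lambda>z. f z * f' z) (\<lambda>z. p z * f' z + f z * p' z) (\<lambda>z. q z * f' z + f z * q' z)"
proof -
  note [continuous_intros] = wirtinger_C1_continuous[OF assms(1)] wirtinger_C1_continuous[OF assms(2)]
  show ?thesis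
    unfolding wirtinger_C1_def
  proof (intro conjI ballI)
    fix z assume "z \<in> S"
    show "((\<lambda>z. f z * f' z) has_derivative
        (\<lambda>u. (p z * f' z + f z * p' z) * u + (q z * f' z + f z * q' z) * cnj u)) (at z)"
      using wirtinger_C1_D[OF assms(1) \<open>z \<in> S\<close>] wirtinger_C1_D[OF assms(2) \<open>z \<in> S\<close>]
      by (auto intro!: derivative_eq_intros simp: algebra_simps)
  qed (intro continuous_intros)+
qed

lemma wirtinger_C1_id: "wirtinger_C1 S (\<lambda>z. z) (\<lambda>z. 1) (\<lambda>z. 0)"
  unfolding wirtinger_C1_def by auto

section \<open>Averages and primitives along rays from the origin\<close>

lemma radial_in_ball: "z \<in> ball 0 r \<Longrightarrow> t \<in> {0..1} \<Longrightarrow> complex_of_real t * z \<in> ball 0 r"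
  by (auto simp: norm_mult) (meson le_less_trans mult_left_le_one_le norm_ge_zero)

lemma continuous_on_radial:
  assumes "continuous_on (ball 0 r) f"
  shows "continuous_on (ball 0 r \<times> {0..1}) (\<lambda>(z, t). f (complex_of_real t * z))"
proof -
  have "continuous_on (ball 0 r \<times> {0..1}) (\<lambda>x. complex_of_real (snd x) * fst x :: complex)"
    by (intro continuous_intros)
  then show ?thesis
    unfolding split_beta
    by (rule continuous_on_compose2[OF assms]) (use radial_in_ball in auto)
qed

lemma continuous_on_ray:
  assumes "continuous_on (ball 0 r) f" "z \<in> ball 0 r"
  shows "continuous_on {0..1} (\<lambda>t. f (complex_of_real t * z))"
proof -
  have "continuous_on {0..1} (\<lambda>t. complex_of_real t * z)"
    by (intro continuous_intros)
  then show ?thesis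
    by (rule continuous_on_compose2[OF assms(1)]) (use assms(2) radial_in_ball in auto)
qed

text \<open>The Leibniz rule for parameter integrals takes derivatives as bounded operators, so
  conjugation is needed in that type to express antilinear parts.\<close>

lift_definition cnj_blinfun :: "complex \<Rightarrow>\<^sub>L complex" is cnj
  by (rule bounded_linear_cnj)

text \<open>Differentiation under the integral sign. The chain rule for scaling by t contributes the
  same factor t to both parts, since t is real.\<close>

lemma wirtinger_C1_radial_integral:
  assumes G: "wirtinger_C1 (ball 0 r) G p q"
  defines "P \<equiv> \<lambda>z. integral {0..1} (\<lambda>t. of_real t * p (of_real t * z))"
    and "Q \<equiv> \<lambda>z. integral {0..1} (\<lambda>t. of_real t * q (of_real t * z))"
  shows "wirtinger_C1 (ball 0 r) (\<lambda>z. integral {0..1} (\<lambda>t. G (of_real t * z))) P Q"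
proof -
  note cont = wirtinger_C1_continuous[OF G]
  have contt: "continuous_on (ball 0 r \<times> {0..1}) (\<lambda>(z, t). complex_of_real t * f (complex_of_real t * z))"
    if "continuous_on (ball 0 r) f" for f
    using continuous_on_radial[OF that] by (auto simp: split_beta intro!: continuous_intros)
  have int: "(\<lambda>t. of_real t * f (of_real t * z)) integrable_on {0..1}"
    if "continuous_on (ball 0 r) f" "z \<in> ball 0 r" for f :: "complex \<Rightarrow> complex" and z
    by (intro integrable_continuous_real continuous_intros continuous_on_ray[where r=r] that)
  define D where "D \<equiv> \<lambda>z t. blinfun_mult_right (of_real t * p (of_real t * z)) +
                (blinfun_mult_right (of_real t * q (of_real t * z)) o\<^sub>L cnj_blinfun)"
  have contD: "continuous_on (ball 0 r \<times> cbox 0 1) (\<lambda>(z, t). D z t)"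
    unfolding D_def split_beta
    using continuous_on_radial[OF cont(1)] continuous_on_radial[OF cont(2)]
    by (intro continuous_intros) (auto simp: split_beta)
  have "((\<lambda>z. integral {0..1} (\<lambda>t. G (of_real t * z))) has_derivative
        (\<lambda>u. P z * u + Q z * cnj u)) (at z)" if z: "z \<in> ball 0 r" for z
  proof -
    have "((\<lambda>z. integral (cbox 0 1) (\<lambda>t. G (of_real t * z))) has_derivative
        blinfun_apply (integral (cbox 0 1) (D z))) (at z within ball 0 r)"
    proof (rule leibniz_rule[OF _ _ contD z convex_ball])
      fix z :: complex and t :: real assume z: "z \<in> ball 0 r" and t: "t \<in> cbox 0 1"
      have tz: "of_real t * z \<in> ball 0 r" using radial_in_ball[OF z] t by simp
      have "((\<lambda>w. of_real t * w) has_derivative (\<lambda>u. of_real t * u)) (at z)"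
        by (auto intro!: derivative_eq_intros)
      from has_derivative_compose[OF this wirtinger_C1_D[OF G tz]]
      have "((\<lambda>z. G (of_real t * z)) has_derivative
          (\<lambda>u. p (of_real t * z) * (of_real t * u) + q (of_real t * z) * cnj (of_real t * u))) (at z)" .
      moreover have "blinfun_apply (D z t) =
          (\<lambda>u. p (of_real t * z) * (of_real t * u) + q (of_real t * z) * cnj (of_real t * u))"
        by (rule ext) (simp add: D_def blinfun.add_left cnj_blinfun.rep_eq)
      ultimately show "((\<lambda>z. G (of_real t * z)) has_derivative blinfun_apply (D z t)) (at z within ball 0 r)"
        by (simp only: has_derivative_at_withinI)
    next
      fix z :: complex assume z: "z \<in> ball 0 r"
      show "(\<lambda>t. G (of_real t * z)) integrable_on cbox 0 1"
        by (simp, intro integrable_continuous_real continuous_on_ray[where r=r] cont z)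
    qed
    moreover have "blinfun_apply (integral (cbox 0 1) (D z)) = (\<lambda>u. P z * u + Q z * cnj u)"
    proof
      fix u
      have Dint: "D z integrable_on cbox 0 1"
      proof (rule integrable_continuous)
        have "continuous_on (cbox 0 1) (\<lambda>t. (z, t))" by (intro continuous_intros)
        then have "continuous_on (cbox 0 1) (\<lambda>t. (\<lambda>(z, t). D z t) (z, t))"
          by (rule continuous_on_compose2[OF contD]) (use z in auto)
        then show "continuous_on (cbox 0 1) (D z)" by simp
      qed
      have "blinfun_apply (integral (cbox 0 1) (D z)) u = integral (cbox 0 1) (\<lambda>t. D z t u)"
        by (rule blinfun_apply_integral[OF Dint])
      also have "\<dots> = integral {0..1} (\<lambda>t. of_real t * p (of_real t * z) * u
                        + of_real t * q (of_real t * z) * cnj u)"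
        by (simp add: D_def blinfun.add_left cnj_blinfun.rep_eq)
      also have "\<dots> = P z * u + Q z * cnj u"
        unfolding P_def Q_def
        by (subst integral_add)
           (auto intro!: integrable_on_mult_left int cont z)
      finally show "blinfun_apply (integral (cbox 0 1) (D z)) u = P z * u + Q z * cnj u" .
    qed
    ultimately show ?thesis
      by (simp add: at_within_open[OF z])
  qed
  moreover have "continuous_on (ball 0 r) P" "continuous_on (ball 0 r) Q"
    unfolding P_def Q_def
    using integral_continuous_on_param[of "ball 0 r" "0::real" 1] contt[OF cont(1)] contt[OF cont(2)]
    by auto
  ultimately show ?thesis
    by (simp add: wirtinger_C1_def)
qed

text \<open>Integrating \<open>d/dt (t G(tz))\<close> removes the derivative \<open>p\<close> of \<open>G\<close>, so that the
  derivative of the radial primitive differs from that of an exact primitive only by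
  the obstruction \<open>q\<close> to holomorphy.\<close>

lemma wirtinger_C1_radial_primitive:
  assumes G: "wirtinger_C1 (ball 0 r) G p q"
  defines "Q \<equiv> \<lambda>z. integral {0..1} (\<lambda>t. of_real t * q (of_real t * z))"
  shows "wirtinger_C1 (ball 0 r) (\<lambda>z. c + z * integral {0..1} (\<lambda>t. G (of_real t * z)))
           (\<lambda>z. G z - cnj z * Q z) (\<lambda>z. z * Q z)"
proof -
  note cont = wirtinger_C1_continuous[OF G]
  define P where "P = (\<lambda>z. integral {0..1} (\<lambda>t. of_real t * p (of_real t * z)))"
  define I where "I = (\<lambda>z. integral {0..1} (\<lambda>t. G (of_real t * z)))"
  have W: "wirtinger_C1 (ball 0 r) (\<lambda>z. c + z * I z) (\<lambda>z. 0 + (1 * I z + z * P z)) (\<lambda>z. 0 + (0 * I z + z * Q z))"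
    unfolding P_def Q_def I_def
    by (intro wirtinger_C1_add wirtinger_C1_mult wirtinger_C1_const wirtinger_C1_id
        wirtinger_C1_radial_integral G)
  have eq: "I z + z * P z = G z - cnj z * Q z" if z: "z \<in> ball 0 r" for z
  proof -
    have tp: "((\<lambda>t. of_real t * f (of_real t * z)) has_integral
        integral {0..1} (\<lambda>t. of_real t * f (of_real t * z))) {0..1}"
      if "continuous_on (ball 0 r) f" for f :: "complex \<Rightarrow> complex"
      by (intro integrable_integral integrable_continuous_real continuous_intros continuous_on_ray[where r=r] z that)
    have tI: "((\<lambda>t. G (of_real t * z)) has_integral I z) {0..1}"
      unfolding I_def
      by (intro integrable_integral integrable_continuous_real continuous_intros continuous_on_ray[where r=r] z cont)
    \<comment> \<open>One integral is evaluated twice: term by term, and as the increment of t G(tz)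
      over the unit interval.\<close>
    have "((\<lambda>t. G (of_real t * z) + (of_real t * p (of_real t * z) * z + of_real t * q (of_real t * z) * cnj z))
       has_integral I z + (P z * z + Q z * cnj z)) {0..1}"
      unfolding P_def Q_def
      by (intro has_integral_add has_integral_mult_left tp cont tI)
    moreover have "((\<lambda>t. G (of_real t * z) + (of_real t * p (of_real t * z) * z + of_real t * q (of_real t * z) * cnj z))
       has_integral (of_real 1 * G (of_real 1 * z) - of_real 0 * G (of_real 0 * z))) {0..1}"
    proof (rule fundamental_theorem_of_calculus)
      fix t :: real assume t: "t \<in> {0..1}"
      have "((\<lambda>t. of_real t * z) has_derivative (\<lambda>s. of_real s * z)) (at t)"
        by (auto intro!: derivative_eq_intros)
      from has_derivative_compose[OF this wirtinger_C1_D[OF G radial_in_ball[OF z t]]]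
      have "((\<lambda>t. G (of_real t * z)) has_vector_derivative
          (p (of_real t * z) * z + q (of_real t * z) * cnj z)) (at t)"
        by (simp add: has_vector_derivative_def scaleR_conv_of_real algebra_simps)
      moreover have "((\<lambda>t. complex_of_real t) has_vector_derivative 1) (at t)"
        by (auto intro!: derivative_eq_intros)
      ultimately have "((\<lambda>t. of_real t * G (of_real t * z)) has_vector_derivative
         of_real t * (p (of_real t * z) * z + q (of_real t * z) * cnj z) + 1 * G (of_real t * z)) (at t)"
        by (intro has_vector_derivative_mult)
      then show "((\<lambda>t. of_real t * G (of_real t * z)) has_vector_derivative
         G (of_real t * z) + (of_real t * p (of_real t * z) * z + of_real t * q (of_real t * z) * cnj z))
         (at t within {0..1})"
        by (auto intro: has_vector_derivative_at_within simp: algebra_simps)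
    qed simp
    ultimately have "I z + (P z * z + Q z * cnj z) = of_real 1 * G (of_real 1 * z) - of_real 0 * G (of_real 0 * z)"
      by (rule has_integral_unique)
    then show ?thesis by (simp add: algebra_simps)
  qed
  have "continuous_on (ball 0 r) (\<lambda>z. G z - cnj z * Q z) \<longleftrightarrow> continuous_on (ball 0 r) (\<lambda>z. 0 + (1 * I z + z * P z))"
    by (rule continuous_on_cong) (auto simp: eq)
  with W have "wirtinger_C1 (ball 0 r) (\<lambda>z. c + z * I z) (\<lambda>z. G z - cnj z * Q z) (\<lambda>z. z * Q z)"
    by (simp add: wirtinger_C1_def eq)
  then show ?thesis
    unfolding I_def .
qed

section \<open>Picard iteration for the linear system\<close>

lemma unit_interval_integral_bound:
  fixes f :: "real \<Rightarrow> complex"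
  assumes "continuous_on {0..1} f" "\<And>t. t \<in> {0..1} \<Longrightarrow> cmod (f t) \<le> M"
  shows "cmod (integral {0..1} f) \<le> M"
  using integral_bound[of 0 1 f M] assms by simp

text \<open>The equations for \<open>aq\<close> and \<open>bq\<close> make the antiholomorphic
  derivative of a f + b cnj f vanish whenever f is a solution. The Picard iterates themselves need
  not be holomorphic, but their failure to be so decays geometrically.\<close>

lemma integrable_linear_system_solvable:
  fixes a b :: "complex \<Rightarrow> complex"
  assumes R: "R > 0"
    and a: "wirtinger_C1 (ball 0 R) a ap aq" and b: "wirtinger_C1 (ball 0 R) b bp bq"
    and aq: "\<And>z. z \<in> ball 0 R \<Longrightarrow> aq z = - (b z * cnj (b z))"
    and bq: "\<And>z. z \<in> ball 0 R \<Longrightarrow> bq z = - (cnj (a z) * b z)"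
  obtains r f where "0 < r" "r \<le> R" "f 0 = w"
    "\<And>z. z \<in> ball 0 r \<Longrightarrow> (f has_field_derivative (a z * f z + b z * cnj (f z))) (at z)"
proof -
  \<comment> \<open>Compactness of the half-radius disc bounds both coefficients; \<open>K\<close>
    is kept at least 1 so that it can be divided by.\<close>
  obtain K where K: "K \<ge> 1" "\<And>z. z \<in> cball 0 (R/2) \<Longrightarrow> cmod (a z) \<le> K \<and> cmod (b z) \<le> K"
  proof -
    have sub: "cball 0 (R/2) \<subseteq> ball (0::complex) R" using R by auto
    have "bounded (a ` cball 0 (R/2))" "bounded (b ` cball 0 (R/2))"
      using wirtinger_C1_continuous(3)[OF a] wirtinger_C1_continuous(3)[OF b] sub
      by (auto intro!: compact_imp_bounded compact_continuous_image intro: continuous_on_subset)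
    then obtain K1 K2 where "\<forall>z\<in>cball 0 (R/2). cmod (a z) \<le> K1" "\<forall>z\<in>cball 0 (R/2). cmod (b z) \<le> K2"
      unfolding bounded_iff by auto
    then have "\<And>z. z \<in> cball 0 (R/2) \<Longrightarrow> cmod (a z) \<le> max 1 (max K1 K2) \<and> cmod (b z) \<le> max 1 (max K1 K2)"
      by (auto simp: le_max_iff_disj)
    then show ?thesis using that[of "max 1 (max K1 K2)"] by auto
  qed
  \<comment> \<open>With K r at most 1/8, the factors 2 K r for the iterates and 3 K r for their
    derivatives are both below 1/2.\<close>
  define r where "r = min (R/2) (1/(8*K))"
  have r: "0 < r" "r \<le> R/2" "K * r \<le> 1/8"
    using R K(1) by (auto simp: r_def min_def field_simps)
  define B where "B = ball (0::complex) r"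
  have BR: "B \<subseteq> ball 0 R" using r R by (auto simp: B_def)
  note a' = wirtinger_C1_subset[OF a BR] and b' = wirtinger_C1_subset[OF b BR]
  have bd: "cmod (a z) \<le> K" "cmod (b z) \<le> K" if "z \<in> B" for z
    using K(2)[of z] that r by (auto simp: B_def)
  have zr: "cmod z \<le> r" if "z \<in> B" for z using that by (auto simp: B_def)
  have tz: "of_real t * z \<in> B" if "z \<in> B" "t \<in> {0..1}" for t z
    using radial_in_ball that by (simp add: B_def)
  define M where "M f z = a z * f z + b z * cnj (f z)" for f z
  define F where "F = rec_nat (\<lambda>z. w) (\<lambda>n f z. w + z * integral {0..1} (\<lambda>t. M f (of_real t * z)))"
  have F0: "F 0 = (\<lambda>z. w)" and FS: "F (Suc n) = (\<lambda>z. w + z * integral {0..1} (\<lambda>t. M (F n) (of_real t * z)))" for n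
    by (simp_all add: F_def)
  \<comment> \<open>This is the antiholomorphic derivative of \<open>M f\<close> when f has
    Wirtinger derivatives p and q.\<close>
  define mq where "mq f p q z = (aq z * f z + a z * q z) + (bq z * cnj (f z) + b z * cnj (p z))" for f p q z
  have WM: "wirtinger_C1 B (M f) (\<lambda>z. (ap z * f z + a z * p z) + (bp z * cnj (f z) + b z * cnj (q z))) (mq f p q)"
    if "wirtinger_C1 B f p q" for f p q
    unfolding M_def mq_def
    by (intro wirtinger_C1_add wirtinger_C1_mult wirtinger_C1_cnj a' b' that)
  define Q where "Q f p q z = integral {0..1} (\<lambda>t. of_real t * mq f p q (of_real t * z))" for f p q z
  have WS: "wirtinger_C1 B (F (Suc n)) (\<lambda>z. M (F n) z - cnj z * Q (F n) p q z) (\<lambda>z. z * Q (F n) p q z)"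
    if "wirtinger_C1 B (F n) p q" for n p q
    using wirtinger_C1_radial_primitive[OF WM[OF that, unfolded B_def]] unfolding Q_def FS B_def .
  have Wex: "\<exists>p q. wirtinger_C1 B (F n) p q" for n
    by (induction n) (use wirtinger_C1_const F0 WS in metis)+
  have contF: "continuous_on B (F n)" for n
    using Wex wirtinger_C1_continuous by blast
  have contM: "continuous_on B (M (F n))" for n
    unfolding M_def using a' b' by (intro continuous_intros contF; simp add: wirtinger_C1_continuous)
  have contMr: "continuous_on {0..1} (\<lambda>t. M (F n) (of_real t * z))" if "z \<in> B" for n z
    using contM that unfolding B_def by (intro continuous_on_ray)
  have Mdiff: "cmod (M f z - M g z) \<le> 2 * K * cmod (f z - g z)" if "z \<in> B" for f g z
  proof -
    have "M f z - M g z = a z * (f z - g z) + b z * cnj (f z - g z)"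
      by (simp add: M_def algebra_simps)
    also have "cmod \<dots> \<le> cmod (a z) * cmod (f z - g z) + cmod (b z) * cmod (f z - g z)"
      by (metis complex_mod_cnj norm_mult norm_triangle_ineq)
    also have "\<dots> \<le> K * cmod (f z - g z) + K * cmod (f z - g z)"
      by (intro add_mono mult_right_mono bd that) auto
    finally show ?thesis by simp
  qed
  \<comment> \<open>The Lipschitz constant 2 K of \<open>M\<close> and the length r of the ray
    contract each difference by the factor 1/4, more than the 1/2 claimed.\<close>
  have d: "\<forall>z\<in>B. cmod (F (Suc n) z - F n z) \<le> cmod w * (1/2) ^ Suc n" for n
  proof (induction n)
    case 0
    show ?case
    proof
      fix z assume z: "z \<in> B"
      have "cmod (integral {0..1} (\<lambda>t. M (F 0) (of_real t * z))) \<le> 2 * K * cmod w"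
      proof (rule unit_interval_integral_bound[OF contMr[OF z]])
        fix t :: real assume "t \<in> {0..1}"
        with Mdiff[OF tz[OF z this], of "F 0" "\<lambda>z. 0"]
        show "cmod (M (F 0) (of_real t * z)) \<le> 2 * K * cmod w" by (simp add: F0 M_def)
      qed
      then have "cmod (F (Suc 0) z - F 0 z) \<le> r * (2 * K * cmod w)"
        using zr[OF z] r unfolding FS by (simp add: F0 norm_mult mult_mono)
      also have "\<dots> = 2 * (K * r) * cmod w" by simp
      also have "\<dots> \<le> 2 * (1/8) * cmod w" by (intro mult_right_mono mult_left_mono r) auto
      also have "\<dots> \<le> cmod w * (1/2) ^ Suc 0" by simp
      finally show "cmod (F (Suc 0) z - F 0 z) \<le> cmod w * (1/2) ^ Suc 0" .
    qed
  next
    case (Suc n)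
    show ?case
    proof
      fix z assume z: "z \<in> B"
      have "cmod (integral {0..1} (\<lambda>t. M (F (Suc n)) (of_real t * z) - M (F n) (of_real t * z)))
              \<le> 2 * K * (cmod w * (1/2) ^ Suc n)"
      proof (rule unit_interval_integral_bound)
        fix t :: real assume "t \<in> {0..1}"
        note t = tz[OF z this]
        have "cmod (M (F (Suc n)) (of_real t * z) - M (F n) (of_real t * z))
            \<le> 2 * K * cmod (F (Suc n) (of_real t * z) - F n (of_real t * z))"
          by (rule Mdiff[OF t])
        also have "\<dots> \<le> 2 * K * (cmod w * (1/2) ^ Suc n)"
          using Suc t K(1) by (intro mult_left_mono) auto
        finally show "cmod (M (F (Suc n)) (of_real t * z) - M (F n) (of_real t * z))
              \<le> 2 * K * (cmod w * (1/2) ^ Suc n)" .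
      qed (intro continuous_intros contMr z)
      moreover have "F (Suc (Suc n)) z - F (Suc n) z =
          z * integral {0..1} (\<lambda>t. M (F (Suc n)) (of_real t * z) - M (F n) (of_real t * z))"
        unfolding integral_diff[OF integrable_continuous_real[OF contMr[OF z]] integrable_continuous_real[OF contMr[OF z]]]
        unfolding fun_cong[OF FS, of "Suc n"] fun_cong[OF FS, of n z] by (simp add: algebra_simps)
      ultimately have "cmod (F (Suc (Suc n)) z - F (Suc n) z) \<le> r * (2 * K * (cmod w * (1/2) ^ Suc n))"
        using zr[OF z] r by (simp only: norm_mult, intro mult_mono) auto
      also have "\<dots> = 2 * (K * r) * (cmod w * (1/2) ^ Suc n)" by simp
      also have "\<dots> \<le> 2 * (1/8) * (cmod w * (1/2) ^ Suc n)"
        by (intro mult_right_mono mult_left_mono r) auto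
      also have "\<dots> \<le> cmod w * (1/2) ^ Suc (Suc n)" by simp
      finally show "cmod (F (Suc (Suc n)) z - F (Suc n) z) \<le> cmod w * (1/2) ^ Suc (Suc n)" .
    qed
  qed
  have Qbd: "cmod (z * Q f p q z) \<le> r * L"
    if "wirtinger_C1 B f p q" "\<And>z. z \<in> B \<Longrightarrow> cmod (mq f p q z) \<le> L" "z \<in> B" for f p q z L
  proof -
    have L: "0 \<le> L" using that(2)[OF that(3)] norm_ge_zero order_trans by blast
    have "cmod (Q f p q z) \<le> L"
      unfolding Q_def
    proof (rule unit_interval_integral_bound)
      show "continuous_on {0..1} (\<lambda>t. of_real t * mq f p q (of_real t * z))"
        using wirtinger_C1_continuous(2)[OF WM[OF that(1)]] that(3) unfolding B_def
        by (intro continuous_intros continuous_on_ray)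
      fix t :: real assume t: "t \<in> {0..1}"
      then have "\<bar>t\<bar> * cmod (mq f p q (of_real t * z)) \<le> 1 * L"
        by (intro mult_mono that(2) tz that(3)) auto
      then show "cmod (of_real t * mq f p q (of_real t * z)) \<le> L" by (simp add: norm_mult)
    qed
    then show ?thesis using zr[OF that(3)] r L by (simp add: norm_mult mult_mono)
  qed
  define C where "C = K * cmod w"
  \<comment> \<open>Inserting the integrability conditions leaves only error terms: the difference g
    - f, the antiholomorphic derivative q, and the defect p - M g. For f = \<open>F (Suc n)\<close>
    and g = \<open>F n\<close> all three are small.\<close>
  have mqeq: "mq f p q z = b z * cnj (b z) * (g z - f z) + cnj (a z) * b z * cnj (g z - f z)
      + (a z * q z + b z * cnj (p z - M g z))" if "z \<in> B" for f g p q z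
  proof -
    have "z \<in> ball 0 R" using BR that by auto
    from aq[OF this] bq[OF this] show ?thesis
      unfolding mq_def M_def by (simp add: algebra_simps)
  qed
  \<comment> \<open>By \<open>WS\<close> the next iterate has defect - cnj z Q and antiholomorphic
    derivative z Q. These have equal modulus, so one bound on z Q serves both claims.\<close>
  have main: "\<exists>p q. wirtinger_C1 B (F (Suc n)) p q \<and>
      (\<forall>z\<in>B. cmod (p z - M (F n) z) \<le> C * (1/2)^n \<and> cmod (q z) \<le> C * (1/2)^n)" for n
  proof (induction n)
    case 0
    have W0: "wirtinger_C1 B (F 0) (\<lambda>z. 0) (\<lambda>z. 0)" unfolding F0 by (rule wirtinger_C1_const)
    have "cmod (mq (F 0) (\<lambda>z. 0) (\<lambda>z. 0) z) \<le> 2 * K * C" if z: "z \<in> B" for z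
    proof -
      \<comment> \<open>Comparison with g = 0 leaves just two terms in w, because \<open>F 0\<close>
        is constant.\<close>
      have "mq (F 0) (\<lambda>z. 0) (\<lambda>z. 0) z = - (b z * cnj (b z)) * w - cnj (a z) * b z * cnj w"
        using mqeq[OF z, of "F 0" "\<lambda>z. 0" "\<lambda>z. 0" "\<lambda>z. 0"] by (simp add: F0 M_def)
      also have "cmod \<dots> \<le> cmod (b z) * cmod (b z) * cmod w + cmod (a z) * cmod (b z) * cmod w"
        by (rule order_trans[OF norm_triangle_ineq4]) (simp add: norm_mult)
      also have "\<dots> \<le> K * K * cmod w + K * K * cmod w"
        using K(1) bd[OF z] by (intro add_mono mult_mono) auto
      finally show ?thesis by (simp add: C_def)
    qed
    from Qbd[OF W0 this] have q: "cmod (z * Q (F 0) (\<lambda>z. 0) (\<lambda>z. 0) z) \<le> C" if "z \<in> B" for z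
    proof -
      have "cmod (z * Q (F 0) (\<lambda>z. 0) (\<lambda>z. 0) z) \<le> 2 * (K * r) * C"
        using Qbd[OF W0 \<open>\<And>z. z \<in> B \<Longrightarrow> cmod (mq (F 0) (\<lambda>z. 0) (\<lambda>z. 0) z) \<le> 2 * K * C\<close> that]
        by (simp add: mult_ac)
      also have "\<dots> \<le> 2 * (1/8) * C"
        using K(1) by (intro mult_right_mono mult_left_mono r) (auto simp: C_def)
      also have "\<dots> \<le> C" using K(1) by (simp add: C_def)
      finally show ?thesis .
    qed
    show ?case
      by (rule exI, rule exI, rule conjI[OF WS[OF W0]]) (use q in \<open>simp add: norm_mult\<close>)
  next
    case (Suc n)
    then obtain p q where W: "wirtinger_C1 B (F (Suc n)) p q"
      and p: "\<And>z. z \<in> B \<Longrightarrow> cmod (p z - M (F n) z) \<le> C * (1/2)^n"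
      and q: "\<And>z. z \<in> B \<Longrightarrow> cmod (q z) \<le> C * (1/2)^n" by blast
    have *: "cmod (mq (F (Suc n)) p q z) \<le> 3 * K * C * (1/2)^n" if z: "z \<in> B" for z
    proof -
      define e where "e = F n z - F (Suc n) z"
      have e: "cmod e \<le> cmod w * (1/2)^n * (1/2)" using d[of n] z by (simp add: e_def norm_minus_commute)
      have "mq (F (Suc n)) p q z = b z * cnj (b z) * e + cnj (a z) * b z * cnj e
          + (a z * q z + b z * cnj (p z - M (F n) z))"
        unfolding e_def by (rule mqeq[OF z])
      also have "cmod \<dots> \<le> (cmod (b z) * cmod (b z) * cmod e + cmod (a z) * cmod (b z) * cmod e)
          + (cmod (a z) * cmod (q z) + cmod (b z) * cmod (p z - M (F n) z))"
        by (intro order_trans[OF norm_triangle_ineq] add_mono)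
           (simp_all only: norm_mult complex_mod_cnj order_refl)
      also have "\<dots> \<le> (K * K * (cmod w * (1/2)^n * (1/2)) + K * K * (cmod w * (1/2)^n * (1/2)))
          + (K * (C * (1/2)^n) + K * (C * (1/2)^n))"
        using K(1) bd[OF z] p[OF z] q[OF z] e by (intro add_mono mult_mono) auto
      also have "\<dots> = 3 * K * C * (1/2)^n" by (simp add: C_def algebra_simps)
      finally show ?thesis .
    qed
    have q': "cmod (z * Q (F (Suc n)) p q z) \<le> C * (1/2)^Suc n" if "z \<in> B" for z
    proof -
      have "cmod (z * Q (F (Suc n)) p q z) \<le> 3 * (K * r) * (C * (1/2)^n)"
        using Qbd[OF W * that] by (simp add: mult_ac)
      also have "\<dots> \<le> 3 * (1/8) * (C * (1/2)^n)"
        using K(1) by (intro mult_right_mono mult_left_mono r) (auto simp: C_def)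
      also have "\<dots> \<le> C * (1/2)^Suc n" using K(1) by (simp add: C_def)
      finally show ?thesis .
    qed
    show ?case
      by (rule exI, rule exI, rule conjI[OF WS[OF W]]) (use q' in \<open>simp add: norm_mult\<close>)
  qed
  obtain p q where pq: "\<And>n. wirtinger_C1 B (F (Suc n)) (p n) (q n)"
      "\<And>n z. z \<in> B \<Longrightarrow> cmod (p n z - M (F n) z) \<le> C * (1/2)^n"
      "\<And>n z. z \<in> B \<Longrightarrow> cmod (q n z) \<le> C * (1/2)^n"
    using main by metis
  obtain f where lim: "uniform_limit B F f sequentially"
  proof -
    have "uniform_limit B (\<lambda>n z. \<Sum>k<n. F (Suc k) z - F k z) (\<lambda>z. \<Sum>k. F (Suc k) z - F k z) sequentially"
    proof (rule Weierstrass_m_test)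
      show "summable (\<lambda>n. cmod w * (1/2) ^ Suc n)"
        by (intro summable_mult summable_Suc_iff[THEN iffD2] summable_geometric) simp
    qed (use d in auto)
    from uniform_limit_add[OF uniform_limit_const this, of "\<lambda>z. w"]
    have "uniform_limit B (\<lambda>n z. w + (\<Sum>k<n. F (Suc k) z - F k z)) (\<lambda>z. w + (\<Sum>k. F (Suc k) z - F k z)) sequentially" .
    moreover have "w + (\<Sum>k<n. F (Suc k) z - F k z) = F n z" for n z
      using sum_lessThan_telescope[of "\<lambda>k. F k z" n] by (simp add: F0)
    ultimately show ?thesis by (intro that) simp
  qed
  have limz: "(\<lambda>n. F n z) \<longlonglongrightarrow> f z" if "z \<in> B" for z
    using tendsto_uniform_limitI[OF lim that] .
  have F0w: "F n 0 = w" for n by (cases n) (simp_all add: F0 FS)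
  have B0: "0 \<in> B" using r by (simp add: B_def)
  \<comment> \<open>Derivatives that converge uniformly yield the derivative of the limit:
    \<open>p n\<close> tends to \<open>M f\<close> and \<open>q n\<close> to 0, so the limit is
    holomorphic. The index is shifted because \<open>p n\<close> and \<open>q n\<close> belong to
    \<open>F (Suc n)\<close>.\<close>
  have "\<exists>g. \<forall>z\<in>B. (\<lambda>n. F (Suc n) z) \<longlonglongrightarrow> g z \<and> (g has_derivative (\<lambda>u. M f z * u)) (at z within B)"
  proof (rule has_derivative_sequence[OF _ _ _ B0])
    show "convex B" by (simp add: B_def)
    show "(F (Suc n) has_derivative (\<lambda>u. p n z * u + q n z * cnj u)) (at z within B)" if "z \<in> B" for n z
      using wirtinger_C1_D[OF pq(1) that] by (rule has_derivative_at_withinI)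
    show "(\<lambda>n. F (Suc n) 0) \<longlonglongrightarrow> w" by (simp add: F0w)
    fix e :: real assume e: "e > 0"
    \<comment> \<open>The error e is split evenly: one half covers \<open>p n\<close> and
      \<open>q n\<close>, the other comes from the distance e/(4K) to the limit times the Lipschitz
      constant 2 K in \<open>Mdiff\<close>.\<close>
    have "(\<lambda>n. 2 * C * (1/2)^n) \<longlonglongrightarrow> 2 * C * 0"
      by (intro tendsto_mult tendsto_const LIMSEQ_realpow_zero) auto
    then have 1: "\<forall>\<^sub>F n in sequentially. 2 * C * (1/2)^n < e/2"
      using e by (intro order_tendstoD) auto
    have "\<forall>\<^sub>F n in sequentially. \<forall>z\<in>B. dist (F n z) (f z) < e / (4*K)"
      using lim e K(1) by (intro uniform_limitD) auto
    with 1 show "\<forall>\<^sub>F n in sequentially. \<forall>z\<in>B. \<forall>u. cmod (p n z * u + q n z * cnj u - M f z * u) \<le> e * cmod u"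
    proof eventually_elim
      case (elim n)
      show ?case
      proof (intro ballI allI)
        fix z u assume z: "z \<in> B"
        have "p n z * u + q n z * cnj u - M f z * u
            = (p n z - M (F n) z) * u + q n z * cnj u + (M (F n) z - M f z) * u"
          by (simp add: algebra_simps)
        also have "cmod \<dots> \<le> cmod (p n z - M (F n) z) * cmod u + cmod (q n z) * cmod u + cmod (M (F n) z - M f z) * cmod u"
          by (intro order_trans[OF norm_triangle_ineq] add_mono)
             (simp_all only: norm_mult complex_mod_cnj order_refl)
        also have "\<dots> = (cmod (p n z - M (F n) z) + cmod (q n z) + cmod (M (F n) z - M f z)) * cmod u"
          by (simp add: algebra_simps)
        also have "\<dots> \<le> (C * (1/2)^n + C * (1/2)^n + 2 * K * cmod (F n z - f z)) * cmod u"
          by (intro mult_right_mono add_mono pq Mdiff z) auto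
        also have "\<dots> \<le> (e/2 + 2 * K * (e / (4*K))) * cmod u"
        proof (intro mult_right_mono add_mono mult_left_mono)
          show "cmod (F n z - f z) \<le> e / (4*K)" using elim(2) z by (auto simp: dist_norm intro: less_imp_le)
        qed (use elim(1) K(1) in auto)
        also have "\<dots> = e * cmod u" using K(1) by (simp add: field_simps)
        finally show "cmod (p n z * u + q n z * cnj u - M f z * u) \<le> e * cmod u" .
      qed
    qed
  qed
  then obtain g where g: "\<And>z. z \<in> B \<Longrightarrow> (\<lambda>n. F (Suc n) z) \<longlonglongrightarrow> g z"
    "\<And>z. z \<in> B \<Longrightarrow> (g has_derivative (\<lambda>u. M f z * u)) (at z within B)" by blast
  have gf: "g z = f z" if "z \<in> B" for z
    using LIMSEQ_unique[OF g(1)[OF that] LIMSEQ_Suc[OF limz[OF that]]] .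
  show ?thesis
  proof (rule that[OF r(1)])
    show "r \<le> R" using r R by simp
    show "g 0 = w" using g(1)[OF B0] by (simp add: F0w LIMSEQ_const_iff)
    fix z :: complex assume "z \<in> ball 0 r"
    then have z: "z \<in> B" by (simp add: B_def)
    have "(g has_derivative (\<lambda>u. M f z * u)) (at z)"
      using g(2)[OF z] at_within_open[OF z] by (simp add: B_def)
    then show "(g has_field_derivative (a z * g z + b z * cnj (g z))) (at z)"
      by (simp add: has_field_derivative_def M_def gf[OF z] mult_commute_abs)
  qed
qed

section \<open>Smoothness\<close>

text \<open>On an open set, agreement on \<open>S\<close> is agreement near each point, so
  derivatives agree and the induction continues. This transfers regularity from formulas valid only
  on \<open>S\<close>.\<close>

lemma Ck_on_cong:
  assumes "open S" "\<And>z. z \<in> S \<Longrightarrow> f z = g z" "Ck_on k S f"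
  shows "Ck_on k S g"
  using assms(2,3)
proof (induction k arbitrary: f g)
  case 0
  then show ?case using continuous_on_cong[of S S f g] by simp
next
  case (Suc k)
  have 1: "g differentiable (at z)" if "z \<in> S" for z
  proof -
    have "f differentiable (at z)" using Suc.prems(2) that by simp
    then obtain D where "(f has_derivative D) (at z)" by (auto simp: differentiable_def)
    then have "(g has_derivative D) (at z)"
      by (rule has_derivative_transform_within_open[OF _ assms(1) that]) (rule Suc.prems)
    then show ?thesis by (auto simp: differentiable_def)
  qed
  have 2: "frechet_derivative f (at z) = frechet_derivative g (at z)" if "z \<in> S" for z
    using Suc.prems that
    by (intro frechet_derivative_transform_within_open[OF _ assms(1) that]) auto
  have "Ck_on k S (\<lambda>z. frechet_derivative g (at z) v)" for v
    by (rule Suc.IH[of "\<lambda>z. frechet_derivative f (at z) v"]) (use 2 Suc.prems in auto)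
  with 1 show ?case by simp
qed

lemma smooth_on_bounded_linear:
  assumes "open S" "bounded_linear L" "smooth_on S f"
  shows "smooth_on S (\<lambda>z. L (f z))"
proof -
  have "Ck_on k S (\<lambda>z. L (f z))" if "Ck_on k S f" for k f
    using that
  proof (induction k arbitrary: f)
    case 0
    then show ?case using bounded_linear.continuous_on[OF assms(2)] by simp
  next
    case (Suc k)
    have D: "((\<lambda>z. L (f z)) has_derivative (\<lambda>v. L (frechet_derivative f (at z) v))) (at z)" if "z \<in> S" for z
      using Suc.prems that
      by (intro bounded_linear.has_derivative[OF assms(2)]) (simp add: frechet_derivative_works)
    have "Ck_on k S (\<lambda>z. frechet_derivative (\<lambda>z. L (f z)) (at z) v)" for v
      by (rule Ck_on_cong[OF assms(1), of "\<lambda>z. L (frechet_derivative f (at z) v)"])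
         (use Suc frechet_derivative_at[OF D] in \<open>auto dest: fun_cong\<close>)
    then show ?case using D by (auto simp: differentiable_def)
  qed
  with assms(3) show ?thesis by (auto simp: smooth_on_def)
qed

lemma frechet_derivative_field:
  "(f has_field_derivative D) (at z) \<Longrightarrow> frechet_derivative f (at z) v = D * v"
  using frechet_derivative_at[of f "(*) D" z] by (simp add: has_field_derivative_def)

text \<open>The derivative in direction v is \<open>deriv f z * v\<close>, which is holomorphic
  again; this closes the induction over the order.\<close>

lemma smooth_on_holomorphic:
  assumes "open S" "f holomorphic_on S"
  shows "smooth_on S f"
proof -
  have "Ck_on k S f" if "f holomorphic_on S" for k f
    using that
  proof (induction k arbitrary: f)
    case 0
    then show ?case by (simp add: holomorphic_on_imp_continuous_on)
  next
    case (Suc k)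
    have D: "(f has_field_derivative deriv f z) (at z)" if "z \<in> S" for z
      using holomorphic_derivI[OF Suc.prems assms(1) that] .
    have "Ck_on k S (\<lambda>z. frechet_derivative f (at z) v)" for v
    proof (rule Ck_on_cong[OF assms(1)])
      show "Ck_on k S (\<lambda>z. deriv f z * v)"
        using Suc.prems assms(1) by (intro Suc.IH holomorphic_intros)
    qed (simp add: frechet_derivative_field[OF D])
    then show ?case using D by (auto simp: differentiable_def has_field_derivative_def)
  qed
  with assms(2) show ?thesis by (auto simp: smooth_on_def)
qed

lemma smooth_on_const: "smooth_on S (\<lambda>z. c)"
proof -
  have "Ck_on k S (\<lambda>z. c)" for k
    by (induction k arbitrary: c) auto
  then show ?thesis by (simp add: smooth_on_def)
qed

lemma smooth_on_has_derivative:
  assumes "smooth_on S f" "z \<in> S"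
  shows "(f has_derivative frechet_derivative f (at z)) (at z)"
proof -
  have "Ck_on (Suc 0) S f" using assms(1) by (simp only: smooth_on_def)
  with assms(2) show ?thesis by (simp add: frechet_derivative_works)
qed

text \<open>A real-linear map D splits into a complex-linear part with coefficient (D 1 - i D i)/2
  and an antilinear part with coefficient (D 1 + i D i)/2.\<close>

lemma smooth_on_wirtinger_C1:
  assumes "smooth_on S f"
  obtains p q where "wirtinger_C1 S f p q"
proof -
  define D where "D z = frechet_derivative f (at z)" for z
  have C1: "Ck_on (Suc 0) S f" using assms by (simp only: smooth_on_def)
  then have cont: "continuous_on S (\<lambda>z. D z v)" for v by (simp add: D_def)
  have *: "D z u = (D z 1 - \<i> * D z \<i>) / 2 * u + (D z 1 + \<i> * D z \<i>) / 2 * cnj u" if "z \<in> S" for z u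
  proof -
    interpret linear "D z"
      using C1 that by (simp add: D_def linear_frechet_derivative)
    have "D z u = D z (Re u *\<^sub>R 1 + Im u *\<^sub>R \<i>)"
      by (metis complex_eq mult.commute scaleR_conv_of_real mult.right_neutral)
    also have "\<dots> = Re u *\<^sub>R D z 1 + Im u *\<^sub>R D z \<i>" by (simp only: add scaleR)
    finally show ?thesis by (auto simp: complex_eq_iff field_simps)
  qed
  have "wirtinger_C1 S f (\<lambda>z. (D z 1 - \<i> * D z \<i>) / 2) (\<lambda>z. (D z 1 + \<i> * D z \<i>) / 2)"
    unfolding wirtinger_C1_def
  proof (intro conjI ballI)
    fix z assume z: "z \<in> S"
    have "(f has_derivative D z) (at z)"
      using smooth_on_has_derivative[OF assms z] by (simp add: D_def)
    moreover have "D z = (\<lambda>u. (D z 1 - \<i> * D z \<i>) / 2 * u + (D z 1 + \<i> * D z \<i>) / 2 * cnj u)"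
      using *[OF z] by (rule ext)
    ultimately show "(f has_derivative (\<lambda>u. (D z 1 - \<i> * D z \<i>) / 2 * u + (D z 1 + \<i> * D z \<i>) / 2 * cnj u)) (at z)"
      by metis
  qed (intro continuous_intros cont; simp)+
  with that show ?thesis .
qed

section \<open>The local form of a special Kaehler structure\<close>

text \<open>Together with \<open>anti_coeff\<close> this splits v \<mapsto> \<Gamma>(1, v) into its
  complex-linear and antilinear parts, with coefficients a and b.\<close>

definition lin_coeff :: "'a connection \<Rightarrow> 'a chart \<Rightarrow> complex \<Rightarrow> complex" where
  "lin_coeff \<Gamma> c z = (\<Gamma> c z 1 1 - \<i> * \<Gamma> c z 1 \<i>) / 2"

definition anti_coeff :: "'a connection \<Rightarrow> 'a chart \<Rightarrow> complex \<Rightarrow> complex" where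
  "anti_coeff \<Gamma> c z = (\<Gamma> c z 1 1 + \<i> * \<Gamma> c z 1 \<i>) / 2"

lemma bilinear_complex_expand:
  fixes f :: "complex \<Rightarrow> complex \<Rightarrow> 'b::real_vector"
  assumes "bilinear f"
  shows "f u v = (Re u * Re v) *\<^sub>R f 1 1 + (Re u * Im v) *\<^sub>R f 1 \<i>
           + (Im u * Re v) *\<^sub>R f \<i> 1 + (Im u * Im v) *\<^sub>R f \<i> \<i>"
proof -
  have *: "w = Re w *\<^sub>R 1 + Im w *\<^sub>R \<i>" for w
    by (metis complex_eq mult.commute scaleR_conv_of_real mult.right_neutral)
  have "f u v = f (Re u *\<^sub>R 1 + Im u *\<^sub>R \<i>) (Re v *\<^sub>R 1 + Im v *\<^sub>R \<i>)"
    using * by metis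
  then show ?thesis
    by (simp add: bilinear_ladd[OF assms] bilinear_radd[OF assms] bilinear_lmul[OF assms]
        bilinear_rmul[OF assms] scaleR_add_right add_ac mult.commute)
qed

lemma dir_deriv_const [simp]: "dir_deriv X (\<lambda>w. c) = (\<lambda>z. 0)"
  by (simp add: dir_deriv_def)

lemma cov_deriv_const [simp]: "cov_deriv \<Gamma> c X (\<lambda>w. v) = (\<lambda>z. \<Gamma> c z (X z) v)"
  by (simp add: cov_deriv_def)

lemma lie_bracket_const [simp]: "lie_bracket (\<lambda>w. u) (\<lambda>w. v) = (\<lambda>z. 0)"
  by (simp add: lie_bracket_def)

lemma cov_deriv_I_const: "cov_deriv_I \<Gamma> c (\<lambda>w. u) (\<lambda>w. v) = (\<lambda>z. \<Gamma> c z u (\<i> * v) - \<i> * \<Gamma> c z u v)"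
  by (simp add: cov_deriv_I_def)

text \<open>Constant fields suffice. Vanishing torsion makes \<Gamma> symmetric, and then the
  condition on I lets the factor i pass between the two slots. So \<Gamma>(i, i) = - \<Gamma>(1, 1),
  and \<Gamma>(1, 1) and \<Gamma>(1, i) determine all values.\<close>

lemma special_kaehler_christoffel:
  assumes "special_kaehler A g \<Gamma>" "c \<in> A" "z \<in> chart_image c"
  shows "\<Gamma> c z u v = lin_coeff \<Gamma> c z * u * v + anti_coeff \<Gamma> c z * cnj u * cnj v"
proof -
  have bil: "bilinear (\<Gamma> c z)"
    using assms unfolding special_kaehler_def tangent_connection_def by blast
  have sym: "\<Gamma> c z u v = \<Gamma> c z v u" for u v
  proof -
    have "torsion_free A \<Gamma>" using assms by (simp add: special_kaehler_def)
    then have "cov_deriv \<Gamma> c (\<lambda>w. u) (\<lambda>w. v) z - cov_deriv \<Gamma> c (\<lambda>w. v) (\<lambda>w. u) z - lie_bracket (\<lambda>w. u) (\<lambda>w. v) z = 0"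
      unfolding torsion_free_def using assms(2,3) smooth_on_const by blast
    then show ?thesis by simp
  qed
  have I: "\<Gamma> c z u (\<i> * v) = \<Gamma> c z (\<i> * u) v" for u v
  proof -
    have "cov_deriv_I \<Gamma> c (\<lambda>w. u) (\<lambda>w. v) z = cov_deriv_I \<Gamma> c (\<lambda>w. v) (\<lambda>w. u) z"
      using assms smooth_on_const unfolding special_kaehler_def by blast
    then show ?thesis using sym[of u v] sym[of v "\<i> * u"] by (simp add: cov_deriv_I_const)
  qed
  have "\<Gamma> c z \<i> 1 = \<Gamma> c z 1 \<i>" by (rule sym)
  moreover have "\<Gamma> c z \<i> \<i> = - \<Gamma> c z 1 1"
    using I[of \<i> 1] bilinear_lneg[OF bil, of 1 1] by simp
  ultimately have "\<Gamma> c z u v = (Re u * Re v) *\<^sub>R \<Gamma> c z 1 1 + (Re u * Im v) *\<^sub>R \<Gamma> c z 1 \<i>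
           + (Im u * Re v) *\<^sub>R \<Gamma> c z 1 \<i> - (Im u * Im v) *\<^sub>R \<Gamma> c z 1 1"
    using bilinear_complex_expand[OF bil, of u v] by simp
  then show ?thesis
    unfolding lin_coeff_def anti_coeff_def by (simp add: complex_eq_iff field_simps)
qed

lemma christoffel_coeffs_outside:
  assumes "tangent_connection A \<Gamma>" "c \<notin> A \<or> z \<notin> chart_image c"
  shows "lin_coeff \<Gamma> c z = 0" "anti_coeff \<Gamma> c z = 0" "\<Gamma> c z u v = 0"
proof -
  have "\<Gamma> c z u v = 0" for u v
    using assms unfolding tangent_connection_def by blast
  then show "lin_coeff \<Gamma> c z = 0" "anti_coeff \<Gamma> c z = 0" "\<Gamma> c z u v = 0"
    by (simp_all add: lin_coeff_def anti_coeff_def)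
qed

text \<open>The zero default outside the chart image gives an equality of functions, which can be
  rewritten under a derivative.\<close>

lemma special_kaehler_christoffel_fun:
  assumes "special_kaehler A g \<Gamma>" "c \<in> A"
  shows "(\<lambda>z. \<Gamma> c z u v) = (\<lambda>z. lin_coeff \<Gamma> c z * u * v + anti_coeff \<Gamma> c z * cnj u * cnj v)"
proof
  fix z
  have "tangent_connection A \<Gamma>" using assms by (simp add: special_kaehler_def)
  then show "\<Gamma> c z u v = lin_coeff \<Gamma> c z * u * v + anti_coeff \<Gamma> c z * cnj u * cnj v"
    using special_kaehler_christoffel[OF assms] christoffel_coeffs_outside[of A \<Gamma> c z]
    by (cases "z \<in> chart_image c") simp_all
qed

section \<open>The conformal factor of the metric\<close>

text \<open>Invariance under I gives g(i, i) = g(1, 1) and g(1, i) = g(i, -1) = - g(1, i), so g is a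
  multiple of the Euclidean inner product.\<close>

lemma kaehler_metric_conformal:
  assumes "kaehler_metric A g" "c \<in> A" "z \<in> chart_image c"
  shows "g c z u v = g c z 1 1 * Re (u * cnj v)" "g c z 1 1 > 0"
proof -
  have bil: "bilinear (g c z)" and sym: "\<And>u v. g c z u v = g c z v u"
    and pos: "\<And>u. u \<noteq> 0 \<Longrightarrow> g c z u u > 0"
    and I: "\<And>u v. g c z (\<i> * u) (\<i> * v) = g c z u v"
    using assms unfolding kaehler_metric_def by blast+
  show "g c z 1 1 > 0" by (rule pos) simp
  have ii: "g c z \<i> \<i> = g c z 1 1" using I[of 1 1] by simp
  have "g c z \<i> (-1) = g c z 1 \<i>" using I[of 1 \<i>] by simp
  then have "- g c z 1 \<i> = g c z 1 \<i>" using bilinear_rneg[OF bil] sym by simp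
  then have "g c z 1 \<i> = 0" by simp
  then show "g c z u v = g c z 1 1 * Re (u * cnj v)"
    using bilinear_complex_expand[OF bil, of u v] ii sym[of \<i> 1] by (simp add: algebra_simps)
qed

lemma kaehler_form_conformal:
  assumes "kaehler_metric A g" "c \<in> A" "z \<in> chart_image c"
  shows "kaehler_form g c z u v = g c z 1 1 * Im (cnj u * v)"
  unfolding kaehler_form_def by (subst kaehler_metric_conformal[OF assms]) (simp add: algebra_simps)

text \<open>Testing \<nabla>\<omega> = 0 on the fields 1 and i makes the derivative of \<rho> along
  u equal to \<rho> times the real trace of v \<mapsto> \<Gamma>(u, v). The antilinear part has
  trace 0 and the linear part has trace 2 Re(a u).\<close>

lemma conformal_factor_derivative:
  assumes "special_kaehler A g \<Gamma>" "c \<in> A" "z \<in> chart_image c"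
  shows "((\<lambda>w. g c w 1 1) has_derivative (\<lambda>u. 2 * g c z 1 1 * Re (lin_coeff \<Gamma> c z * u))) (at z)"
proof -
  have km: "kaehler_metric A g" using assms by (simp add: special_kaehler_def)
  have eq: "(\<lambda>w. kaehler_form g c w 1 \<i>) = (\<lambda>w. g c w 1 1)"
  proof
    fix w show "kaehler_form g c w 1 \<i> = g c w 1 1"
    proof (cases "w \<in> chart_image c")
      case True
      then show ?thesis using kaehler_form_conformal[OF km assms(2)] by simp
    next
      case False
      then have "g c w u v = 0" for u v using km unfolding kaehler_metric_def by blast
      then show ?thesis by (simp add: kaehler_form_def)
    qed
  qed
  have "parallel_form2 A \<Gamma> (kaehler_form g)" using assms by (simp add: special_kaehler_def)
  then have "dir_deriv (\<lambda>w. u) (\<lambda>w. kaehler_form g c w 1 \<i>) z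
      - kaehler_form g c z (cov_deriv \<Gamma> c (\<lambda>w. u) (\<lambda>w. 1) z) \<i>
      - kaehler_form g c z 1 (cov_deriv \<Gamma> c (\<lambda>w. u) (\<lambda>w. \<i>) z) = 0" for u
    unfolding parallel_form2_def using assms(2,3) smooth_on_const by blast
  then have D: "frechet_derivative (\<lambda>w. g c w 1 1) (at z) u = 2 * g c z 1 1 * Re (lin_coeff \<Gamma> c z * u)" for u
    unfolding eq kaehler_form_conformal[OF km assms(2,3)] cov_deriv_const
      special_kaehler_christoffel[OF assms] dir_deriv_def
    by (simp add: algebra_simps)
  have "smooth_on (chart_image c) (\<lambda>w. g c w 1 1)"
    using km assms(2) unfolding kaehler_metric_def by blast
  from smooth_on_has_derivative[OF this assms(3)] show ?thesis
    using D by (metis (no_types, lifting) ext)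
qed

text \<open>Both coefficients describe the derivative of the same function \<rho>, and Re(a u) at u
  = 1 and u = i recovers a.\<close>

lemma lin_coeff_determined_by_metric:
  assumes "special_kaehler A g \<Gamma>" "special_kaehler A g \<Gamma>'" "c \<in> A" "z \<in> chart_image c"
  shows "lin_coeff \<Gamma> c z = lin_coeff \<Gamma>' c z"
proof -
  have eq: "(\<lambda>u. 2 * g c z 1 1 * Re (lin_coeff \<Gamma> c z * u)) = (\<lambda>u. 2 * g c z 1 1 * Re (lin_coeff \<Gamma>' c z * u))"
    using conformal_factor_derivative[OF assms(1,3,4)] conformal_factor_derivative[OF assms(2,3,4)]
    by (rule has_derivative_unique)
  have "g c z 1 1 > 0"
    using kaehler_metric_conformal(2)[OF _ assms(3,4)] assms(1) unfolding special_kaehler_def by blast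
  then have "Re (lin_coeff \<Gamma> c z * u) = Re (lin_coeff \<Gamma>' c z * u)" for u
    using fun_cong[OF eq, of u] by (simp del: times_complex.sel)
  from this[of 1] this[of \<i>] show ?thesis by (simp add: complex_eq_iff)
qed

section \<open>Flatness and the holomorphic coefficient of the cubic form\<close>

lemma special_kaehler_coeffs:
  assumes sk: "special_kaehler A g \<Gamma>" and c: "c \<in> A"
  obtains ap aq bp bq where
    "wirtinger_C1 (chart_image c) (lin_coeff \<Gamma> c) ap aq"
    "wirtinger_C1 (chart_image c) (anti_coeff \<Gamma> c) bp bq"
    "\<And>z. z \<in> chart_image c \<Longrightarrow> aq z = - (anti_coeff \<Gamma> c z * cnj (anti_coeff \<Gamma> c z))"
    "\<And>z. z \<in> chart_image c \<Longrightarrow> bp z = - (lin_coeff \<Gamma> c z * anti_coeff \<Gamma> c z)"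
proof -
  have sm: "smooth_on (chart_image c) (\<lambda>z. \<Gamma> c z u v)" for u v
    using sk c unfolding special_kaehler_def tangent_connection_def by blast
  obtain p q where W1: "wirtinger_C1 (chart_image c) (\<lambda>z. \<Gamma> c z 1 1) p q"
    by (rule smooth_on_wirtinger_C1[OF sm])
  obtain p' q' where W2: "wirtinger_C1 (chart_image c) (\<lambda>z. \<Gamma> c z 1 \<i>) p' q'"
    by (rule smooth_on_wirtinger_C1[OF sm])
  have a_eq: "lin_coeff \<Gamma> c = (\<lambda>z. 1/2 * \<Gamma> c z 1 1 + (- \<i>/2) * \<Gamma> c z 1 \<i>)"
    and b_eq: "anti_coeff \<Gamma> c = (\<lambda>z. 1/2 * \<Gamma> c z 1 1 + (\<i>/2) * \<Gamma> c z 1 \<i>)"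
    by (auto simp: lin_coeff_def anti_coeff_def field_simps)
  obtain ap aq where Wa: "wirtinger_C1 (chart_image c) (lin_coeff \<Gamma> c) ap aq"
    unfolding a_eq
    using wirtinger_C1_add[OF wirtinger_C1_mult[OF wirtinger_C1_const W1] wirtinger_C1_mult[OF wirtinger_C1_const W2]]
    by blast
  obtain bp bq where Wb: "wirtinger_C1 (chart_image c) (anti_coeff \<Gamma> c) bp bq"
    unfolding b_eq
    using wirtinger_C1_add[OF wirtinger_C1_mult[OF wirtinger_C1_const W1] wirtinger_C1_mult[OF wirtinger_C1_const W2]]
    by blast
  have flat: "aq z = - (anti_coeff \<Gamma> c z * cnj (anti_coeff \<Gamma> c z)) \<and>
        bp z = - (lin_coeff \<Gamma> c z * anti_coeff \<Gamma> c z)" if z: "z \<in> chart_image c" for z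
  proof -
    define a where "a = lin_coeff \<Gamma> c z"
    define b where "b = anti_coeff \<Gamma> c z"
    have G: "\<Gamma> c z u v = a * u * v + b * cnj u * cnj v" for u v
      unfolding a_def b_def by (rule special_kaehler_christoffel[OF sk c z])
    have d: "frechet_derivative (\<lambda>w. \<Gamma> c w u v) (at z) =
        (\<lambda>s. (ap z * s + aq z * cnj s) * u * v + (bp z * s + bq z * cnj s) * cnj u * cnj v)" for u v
      unfolding special_kaehler_christoffel_fun[OF sk c]
      by (intro frechet_derivative_at[symmetric] has_derivative_add has_derivative_mult_left
          wirtinger_C1_D[OF Wa z] wirtinger_C1_D[OF Wb z])
    have "flat_connection A \<Gamma>" using sk by (simp add: special_kaehler_def)
    then have "cov_deriv \<Gamma> c (\<lambda>w. 1) (cov_deriv \<Gamma> c (\<lambda>w. \<i>) (\<lambda>w. v)) z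
        - cov_deriv \<Gamma> c (\<lambda>w. \<i>) (cov_deriv \<Gamma> c (\<lambda>w. 1) (\<lambda>w. v)) z
        - cov_deriv \<Gamma> c (lie_bracket (\<lambda>w. 1) (\<lambda>w. \<i>)) (\<lambda>w. v) z = 0" for v
      unfolding flat_connection_def using c z smooth_on_const by blast
    then have E: "(ap z + aq z) * \<i> * v + (bp z + bq z) * (- \<i>) * cnj v + \<Gamma> c z 1 (\<Gamma> c z \<i> v)
        - ((ap z * \<i> - aq z * \<i>) * v + (bp z * \<i> - bq z * \<i>) * cnj v + \<Gamma> c z \<i> (\<Gamma> c z 1 v)) = 0" for v
      by (simp add: cov_deriv_def[of \<Gamma> c _ "\<lambda>z. \<Gamma> c z _ _"] dir_deriv_def d G)
    \<comment> \<open>The curvature on the fields 1 and i sends v to 2 i (P v - Q cnj v). Taking v =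
      1 and v = i forces P = Q and P + Q = 0.\<close>
    define P where "P = aq z + b * cnj b"
    define Q where "Q = bp z + a * b"
    have "2 * \<i> * (P - Q) = 0"
      using E[of 1] unfolding G P_def Q_def by (simp add: algebra_simps)
    then have "P = Q" by simp
    have "- 2 * (P + Q) = 0"
      using E[of \<i>] unfolding G P_def Q_def by (simp add: algebra_simps)
    with \<open>P = Q\<close> have "P = 0" "Q = 0" by simp_all
    then show ?thesis unfolding a_def[symmetric] b_def[symmetric] by (simp add: eq_neg_iff_add_eq_0 P_def Q_def)
  qed
  show ?thesis by (rule that[OF Wa Wb]) (use flat in blast)+
qed

definition cubic_coeff :: "'a metric \<Rightarrow> 'a connection \<Rightarrow> 'a chart \<Rightarrow> complex \<Rightarrow> complex" where
  "cubic_coeff g \<Gamma> c z = of_real (g c z 1 1) * cnj (anti_coeff \<Gamma> c z)"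

text \<open>Since \<rho> is real, its antiholomorphic derivative is \<rho> cnj a, while flatness
  gives cnj b the antiholomorphic derivative - cnj a cnj b. The two contributions cancel in the
  product rule.\<close>

lemma cubic_coeff_holomorphic:
  assumes sk: "special_kaehler A g \<Gamma>" and c: "c \<in> A" and op: "open (chart_image c)"
  shows "cubic_coeff g \<Gamma> c holomorphic_on chart_image c"
proof -
  obtain ap aq bp bq where W: "wirtinger_C1 (chart_image c) (anti_coeff \<Gamma> c) bp bq"
    and bp: "\<And>z. z \<in> chart_image c \<Longrightarrow> bp z = - (lin_coeff \<Gamma> c z * anti_coeff \<Gamma> c z)"
    using special_kaehler_coeffs[OF sk c] by metis
  have "cubic_coeff g \<Gamma> c field_differentiable (at z)" if z: "z \<in> chart_image c" for z
  proof -
    define a where "a = lin_coeff \<Gamma> c z"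
    define b where "b = anti_coeff \<Gamma> c z"
    define \<rho> where "\<rho> = g c z 1 1"
    have "((\<lambda>w. complex_of_real (g c w 1 1)) has_derivative (\<lambda>u. of_real (2 * \<rho> * Re (a * u)))) (at z)"
      unfolding \<rho>_def a_def
      by (intro bounded_linear.has_derivative[OF bounded_linear_of_real] conformal_factor_derivative[OF sk c z])
    from has_derivative_mult[OF this bounded_linear.has_derivative[OF bounded_linear_cnj wirtinger_C1_D[OF W z]]]
    have "(cubic_coeff g \<Gamma> c has_derivative
        (\<lambda>u. of_real \<rho> * cnj (bp z * u + bq z * cnj u) + of_real (2 * \<rho> * Re (a * u)) * cnj b)) (at z)"
      by (simp add: cubic_coeff_def[abs_def] \<rho>_def b_def)
    moreover have "of_real \<rho> * cnj (bp z * u + bq z * cnj u) + of_real (2 * \<rho> * Re (a * u)) * cnj b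
        = of_real \<rho> * (cnj (bq z) + a * cnj b) * u" for u
    proof -
      have "complex_of_real (2 * \<rho> * Re (a * u)) = of_real \<rho> * (a * u + cnj (a * u))"
        by (simp only: complex_add_cnj of_real_mult of_real_numeral mult_ac)
      then show ?thesis
        unfolding bp[OF z] a_def[symmetric] b_def[symmetric] by (simp add: algebra_simps)
    qed
    ultimately have "(cubic_coeff g \<Gamma> c has_field_derivative of_real \<rho> * (cnj (bq z) + a * cnj b)) (at z)"
      by (simp add: has_field_derivative_def)
    then show ?thesis by (auto simp: field_differentiable_def)
  qed
  then show ?thesis using op by (simp add: holomorphic_on_def field_differentiable_at_within)
qed

section \<open>Conjugate special coordinates\<close>

text \<open>Inside Re, the antilinear term may be replaced by its conjugate. The covariant
  derivative of Re dZ then becomes the real part of one complex coefficient times X Y, and it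
  vanishes for all fields iff the coefficient does.\<close>

lemma parallel_form1_Re_d_iff:
  assumes sk: "special_kaehler A g \<Gamma>" and c: "c \<in> A" and V: "open V" "V \<subseteq> chart_image c"
    and Z: "Z holomorphic_on V"
  shows "parallel_form1 \<Gamma> c V (Re_d Z) \<longleftrightarrow>
    (\<forall>z\<in>V. deriv (deriv Z) z = lin_coeff \<Gamma> c z * deriv Z z + cnj (anti_coeff \<Gamma> c z) * cnj (deriv Z z))"
    (is "?L \<longleftrightarrow> (\<forall>z\<in>V. deriv (deriv Z) z = ?r z)")
proof -
  have D: "dir_deriv X (\<lambda>w. Re_d Z w (Y w)) z - Re_d Z z (cov_deriv \<Gamma> c X Y z)
        = Re ((deriv (deriv Z) z - ?r z) * X z * Y z)"
    if z: "z \<in> V" and Y: "smooth_on V Y" for X Y z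
  proof -
    have "(deriv Z has_field_derivative deriv (deriv Z) z) (at z)"
      using holomorphic_derivI[OF holomorphic_deriv[OF Z V(1)] V(1) z] .
    then have dZ: "(deriv Z has_derivative (\<lambda>u. deriv (deriv Z) z * u)) (at z)"
      by (simp add: has_field_derivative_def)
    define DY where "DY = frechet_derivative Y (at z)"
    have "((\<lambda>w. Re (deriv Z w * Y w)) has_derivative
        (\<lambda>u. Re (deriv Z z * DY u + deriv (deriv Z) z * u * Y z))) (at z)"
      unfolding DY_def
      by (intro bounded_linear.has_derivative[OF bounded_linear_Re] has_derivative_mult dZ
          smooth_on_has_derivative[OF Y z])
    from frechet_derivative_at[OF this, symmetric]
    have 1: "dir_deriv X (\<lambda>w. Re_d Z w (Y w)) z = Re (deriv Z z * DY (X z) + deriv (deriv Z) z * X z * Y z)"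
      by (simp add: dir_deriv_def Re_d_def)
    have 2: "cov_deriv \<Gamma> c X Y z = DY (X z) + (lin_coeff \<Gamma> c z * X z * Y z + anti_coeff \<Gamma> c z * cnj (X z) * cnj (Y z))"
      unfolding cov_deriv_def dir_deriv_def DY_def
      using special_kaehler_christoffel[OF sk c] z V(2) by auto
    have "Re (deriv Z z * (anti_coeff \<Gamma> c z * cnj (X z) * cnj (Y z)))
        = Re (cnj (deriv Z z * (anti_coeff \<Gamma> c z * cnj (X z) * cnj (Y z))))" by (simp only: cnj.sel)
    also have "\<dots> = Re (cnj (anti_coeff \<Gamma> c z) * cnj (deriv Z z) * X z * Y z)" by (simp add: algebra_simps)
    finally have 3: "Re (deriv Z z * (anti_coeff \<Gamma> c z * cnj (X z) * cnj (Y z)))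
        = Re (cnj (anti_coeff \<Gamma> c z) * cnj (deriv Z z) * X z * Y z)" .
    show ?thesis
      unfolding 1 unfolding Re_d_def 2 distrib_left plus_complex.sel 3 left_diff_distrib distrib_right minus_complex.sel
      by (simp add: mult_ac del: times_complex.sel)
  qed
  show ?thesis
  proof
    assume L: ?L
    show "\<forall>z\<in>V. deriv (deriv Z) z = ?r z"
    proof
      fix z assume z: "z \<in> V"
      have "Re ((deriv (deriv Z) z - ?r z) * u * 1) = 0" for u
      proof -
        have "dir_deriv (\<lambda>w. u) (\<lambda>w. Re_d Z w 1) z - Re_d Z z (cov_deriv \<Gamma> c (\<lambda>w. u) (\<lambda>w. 1) z) = 0"
          using L z smooth_on_const unfolding parallel_form1_def by blast
        then show ?thesis unfolding D[OF z smooth_on_const] .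
      qed
      from this[of 1] this[of \<i>] have "deriv (deriv Z) z - ?r z = 0"
        by (simp add: complex_eq_iff)
      then show "deriv (deriv Z) z = ?r z" by simp
    qed
  next
    assume R: "\<forall>z\<in>V. deriv (deriv Z) z = ?r z"
    show ?L
      unfolding parallel_form1_def
    proof (intro allI impI ballI)
      fix X Y :: vfield and z assume "smooth_on V X \<and> smooth_on V Y" "z \<in> V"
      then show "dir_deriv X (\<lambda>w. Re_d Z w (Y w)) z - Re_d Z z (cov_deriv \<Gamma> c X Y z) = 0"
        using R by (subst D) auto
    qed
  qed
qed

text \<open>Compared with \<open>kaehler_form_conformal\<close>, this reduces the condition on
  \<omega> to the scalar equation \<rho> = Im(cnj Z' W').\<close>

lemma Re_d_wedge:
  "- (Re_d Z z u * Re_d W z v - Re_d Z z v * Re_d W z u) = Im (cnj (deriv Z z) * deriv W z) * Im (cnj u * v)"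
  by (simp add: Re_d_def algebra_simps)

text \<open>In the quotient rule for W'/Z' the terms with a cancel. What remains is a multiple of
  cnj q p - q cnj p, which the condition on \<omega> identifies as - 2 i \<rho>. The result no
  longer involves Z and W, hence is independent of their choice.\<close>

lemma conj_special_coords_cubic:
  assumes sk: "special_kaehler A g \<Gamma>" and c: "c \<in> A"
    and co: "conj_special_coords g \<Gamma> c V Z W" and z: "z \<in> V"
  shows "1 / 4 * (deriv (\<lambda>w. deriv W w / deriv Z w) z / deriv Z z) * deriv Z z ^ 3
           = - \<i> / 2 * cubic_coeff g \<Gamma> c z"
proof -
  have V: "open V" "V \<subseteq> chart_image c" "Z holomorphic_on V" "W holomorphic_on V"
    using co by (auto simp: conj_special_coords_def)
  define p q where "p = deriv Z z" and "q = deriv W z"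
  define \<beta> where "\<beta> = cnj (anti_coeff \<Gamma> c z)"
  define a where "a = lin_coeff \<Gamma> c z"
  have eqs: "deriv (deriv Z) z = a * p + \<beta> * cnj p" "deriv (deriv W) z = a * q + \<beta> * cnj q"
    using parallel_form1_Re_d_iff[OF sk c V(1,2,3)] parallel_form1_Re_d_iff[OF sk c V(1,2,4)] co z
    by (simp_all add: conj_special_coords_def p_def q_def \<beta>_def a_def)
  have km: "kaehler_metric A g" using sk by (simp add: special_kaehler_def)
  have "kaehler_form g c z 1 \<i> = - (Re_d Z z 1 * Re_d W z \<i> - Re_d Z z \<i> * Re_d W z 1)"
    using co z unfolding conj_special_coords_def by blast
  then have \<rho>: "g c z 1 1 = Im (cnj p * q)"
    unfolding Re_d_wedge kaehler_form_conformal[OF km c subsetD[OF V(2) z]] by (simp add: p_def q_def)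
  then have "p \<noteq> 0"
    using kaehler_metric_conformal(2)[OF km c subsetD[OF V(2) z]] by auto
  have "((\<lambda>w. deriv W w / deriv Z w) has_field_derivative
      (deriv (deriv W) z * p - q * deriv (deriv Z) z) / (p * p)) (at z)"
    unfolding p_def q_def
    using V z \<open>p \<noteq> 0\<close>
    by (intro DERIV_divide holomorphic_derivI[OF holomorphic_deriv]) (auto simp: p_def)
  then have "deriv (\<lambda>w. deriv W w / deriv Z w) z = (deriv (deriv W) z * p - q * deriv (deriv Z) z) / (p * p)"
    by (rule DERIV_imp_deriv)
  then have "deriv (\<lambda>w. deriv W w / deriv Z w) z = \<beta> * (cnj q * p - q * cnj p) / (p * p)"
    unfolding eqs by (simp add: algebra_simps)
  moreover have "cnj q * p - q * cnj p = - (2 * \<i> * of_real (Im (cnj p * q)))"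
    by (simp add: complex_eq_iff)
  ultimately have "deriv (\<lambda>w. deriv W w / deriv Z w) z = - (2 * \<i> * of_real (g c z 1 1)) * \<beta> / (p * p)"
    unfolding \<rho> by (simp only: mult.commute)
  then show ?thesis
    using \<open>p \<noteq> 0\<close> unfolding p_def[symmetric] cubic_coeff_def \<beta>_def[symmetric]
    by (simp add: field_simps power3_eq_cube)
qed

text \<open>The terms with \<beta> form a number plus its conjugate and drop out of Im, so Im(cnj F
  H) has derivative 2 Re(a u) times itself. This is the logarithmic derivative of \<rho> as
  well.\<close>

lemma parallel_wedge_derivative:
  assumes sk: "special_kaehler A g \<Gamma>" and c: "c \<in> A" and z: "z \<in> chart_image c"
    and F: "(F has_field_derivative (lin_coeff \<Gamma> c z * F z + \<beta> * cnj (F z))) (at z)"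
    and H: "(H has_field_derivative (lin_coeff \<Gamma> c z * H z + \<beta> * cnj (H z))) (at z)"
  shows "((\<lambda>w. Im (cnj (F w) * H w) / g c w 1 1) has_derivative (\<lambda>u. 0)) (at z)"
proof -
  define a where "a = lin_coeff \<Gamma> c z"
  define \<rho> where "\<rho> = g c z 1 1"
  have \<rho>: "\<rho> > 0"
    using kaehler_metric_conformal(2)[OF _ c z] sk unfolding special_kaehler_def \<rho>_def by blast
  define N where "N = cnj (F z) * H z"
  have "((\<lambda>w. Im (cnj (F w) * H w)) has_derivative
      (\<lambda>u. Im (cnj (F z) * ((a * H z + \<beta> * cnj (H z)) * u) + cnj ((a * F z + \<beta> * cnj (F z)) * u) * H z))) (at z)"
    using F H unfolding has_field_derivative_def a_def
    by (intro bounded_linear.has_derivative[OF bounded_linear_Im] has_derivative_mult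
        bounded_linear.has_derivative[OF bounded_linear_cnj])
  moreover have "Im (cnj (F z) * ((a * H z + \<beta> * cnj (H z)) * u) + cnj ((a * F z + \<beta> * cnj (F z)) * u) * H z)
      = 2 * Re (a * u) * Im N" for u
    unfolding N_def by (simp add: algebra_simps)
  ultimately have D: "((\<lambda>w. Im (cnj (F w) * H w)) has_derivative (\<lambda>u. 2 * Re (a * u) * Im N)) (at z)" by simp
  have "((\<lambda>w. Im (cnj (F w) * H w) / g c w 1 1) has_derivative
      (\<lambda>u. ((2 * Re (a * u) * Im N) * g c z 1 1 - Im (cnj (F z) * H z) * (2 * \<rho> * Re (a * u))) / (g c z 1 1 * g c z 1 1))) (at z)"
    unfolding \<rho>_def a_def
    by (rule has_derivative_divide'[OF D[unfolded a_def] conformal_factor_derivative[OF sk c z]])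
       (use \<rho> in \<open>simp add: \<rho>_def\<close>)
  moreover have "((2 * Re (a * u) * Im N) * g c z 1 1 - Im (cnj (F z) * H z) * (2 * \<rho> * Re (a * u))) / (g c z 1 1 * g c z 1 1) = 0" for u
    unfolding N_def[symmetric] \<rho>_def[symmetric] by simp
  ultimately show ?thesis by (simp only:)
qed

text \<open>Z' and W' are taken as solutions F and H of the linear system. The condition on \<omega>
  is arranged at \<open>z0\<close>, spreads over a disc by \<open>parallel_wedge_derivative\<close>,
  and convexity of the disc provides primitives.\<close>

lemma conj_special_coords_exist:
  assumes sk: "special_kaehler A g \<Gamma>" and c: "c \<in> A" and op: "open (chart_image c)"
    and z0: "z0 \<in> chart_image c"
  obtains V Z W where "conj_special_coords g \<Gamma> c V Z W" "z0 \<in> V"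
proof -
  have km: "kaehler_metric A g" using sk by (simp add: special_kaehler_def)
  obtain ap aq bp bq where
    Wa: "wirtinger_C1 (chart_image c) (lin_coeff \<Gamma> c) ap aq" and
    Wb: "wirtinger_C1 (chart_image c) (anti_coeff \<Gamma> c) bp bq" and
    aq: "\<And>z. z \<in> chart_image c \<Longrightarrow> aq z = - (anti_coeff \<Gamma> c z * cnj (anti_coeff \<Gamma> c z))" and
    bp: "\<And>z. z \<in> chart_image c \<Longrightarrow> bp z = - (lin_coeff \<Gamma> c z * anti_coeff \<Gamma> c z)"
    using special_kaehler_coeffs[OF sk c] by metis
  obtain R where R: "R > 0" "ball z0 R \<subseteq> chart_image c"
    using op z0 openE by blast
  have shift: "wirtinger_C1 (ball 0 R) (\<lambda>z. f (z0 + z)) (\<lambda>z. p (z0 + z)) (\<lambda>z. q (z0 + z))"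
    if "wirtinger_C1 (chart_image c) f p q" for f p q
  proof -
    have in_image: "z0 + z \<in> chart_image c" if "z \<in> ball 0 R" for z
      by (rule subsetD[OF R(2)]) (use that in \<open>simp add: dist_norm\<close>)
    have cont: "continuous_on (ball 0 R) (\<lambda>z. h (z0 + z))" if "continuous_on (chart_image c) h" for h :: "complex \<Rightarrow> complex"
      by (rule continuous_on_compose2[OF that], intro continuous_intros) (use in_image in blast)
    show ?thesis
      unfolding wirtinger_C1_def
    proof (intro conjI ballI cont wirtinger_C1_continuous[OF that])
      fix z :: complex assume "z \<in> ball 0 R"
      then have z: "z0 + z \<in> chart_image c" by (rule in_image)
      have "((\<lambda>z. z0 + z) has_derivative (\<lambda>u. u)) (at z)" by (auto intro!: derivative_eq_intros)
      from has_derivative_compose[OF this wirtinger_C1_D[OF that z]]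
      show "((\<lambda>z. f (z0 + z)) has_derivative (\<lambda>u. p (z0 + z) * u + q (z0 + z) * cnj u)) (at z)" .
    qed
  qed
  \<comment> \<open>The system is solved around 0 with the conjugate of \<open>anti_coeff\<close> as
    its b. Conjugation swaps Wirtinger derivatives, so the flatness equation for \<open>bp\<close>
    becomes the required one for \<open>bq\<close>.\<close>
  have solve: "\<exists>r f. 0 < r \<and> r \<le> R \<and> f z0 = w \<and> (\<forall>z\<in>ball z0 r.
      (f has_field_derivative (lin_coeff \<Gamma> c z * f z + cnj (anti_coeff \<Gamma> c z) * cnj (f z))) (at z))" for w
  proof -
    have ball_shift: "z0 + z \<in> chart_image c" if "z \<in> ball 0 R" for z
      by (rule subsetD[OF R(2)]) (use that in \<open>simp add: dist_norm\<close>)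
    obtain r f where rf: "0 < r" "r \<le> R" "f 0 = w" and
      f: "\<And>z. z \<in> ball 0 r \<Longrightarrow> (f has_field_derivative (lin_coeff \<Gamma> c (z0 + z) * f z +
            cnj (anti_coeff \<Gamma> c (z0 + z)) * cnj (f z))) (at z)"
      using integrable_linear_system_solvable[OF R(1) shift[OF Wa] shift[OF wirtinger_C1_cnj[OF Wb]], of w]
        aq[OF ball_shift] bp[OF ball_shift] by (auto simp: mult.commute)
    have "((\<lambda>z. f (z - z0)) has_field_derivative (lin_coeff \<Gamma> c z * f (z - z0) +
            cnj (anti_coeff \<Gamma> c z) * cnj (f (z - z0)))) (at z)" if z: "z \<in> ball z0 r" for z
    proof -
      have "(f has_field_derivative (lin_coeff \<Gamma> c z * f (z - z0) +
            cnj (anti_coeff \<Gamma> c z) * cnj (f (z - z0)))) (at (z - z0))"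
        using f[of "z - z0"] z by (auto simp: dist_norm norm_minus_commute)
      moreover have "((\<lambda>z. z - z0) has_field_derivative 1) (at z)" by (auto intro!: derivative_eq_intros)
      ultimately show ?thesis using DERIV_chain2 by fastforce
    qed
    with rf show ?thesis by (intro exI[of _ r] exI[of _ "\<lambda>z. f (z - z0)"]) auto
  qed
  \<comment> \<open>The initial values 1 and i \<open>\<rho>0\<close> for F and H give Im(cnj F H) =
    \<open>\<rho>0\<close> at \<open>z0\<close>.\<close>
  define \<rho>0 where "\<rho>0 = g c z0 1 1"
  obtain r1 F where r1: "0 < r1" "r1 \<le> R" and F0: "F z0 = 1"
    and F: "\<And>z. z \<in> ball z0 r1 \<Longrightarrow>
      (F has_field_derivative (lin_coeff \<Gamma> c z * F z + cnj (anti_coeff \<Gamma> c z) * cnj (F z))) (at z)"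
    using solve by metis
  obtain r2 H where r2: "0 < r2" "r2 \<le> R" and H0: "H z0 = \<i> * of_real \<rho>0"
    and H: "\<And>z. z \<in> ball z0 r2 \<Longrightarrow>
      (H has_field_derivative (lin_coeff \<Gamma> c z * H z + cnj (anti_coeff \<Gamma> c z) * cnj (H z))) (at z)"
    using solve by metis
  define V where "V = ball z0 (min r1 r2)"
  have V: "open V" "convex V" "z0 \<in> V" "V \<subseteq> chart_image c" "V \<subseteq> ball z0 r1" "V \<subseteq> ball z0 r2"
    using r1 r2 R by (auto simp: V_def)
  note F = F[OF subsetD[OF V(5)]] and H = H[OF subsetD[OF V(6)]]
  have hol: "F holomorphic_on V" "H holomorphic_on V"
    using F H V(1) by (auto simp: holomorphic_on_open)
  obtain Z where Z: "\<And>z. z \<in> V \<Longrightarrow> (Z has_field_derivative F z) (at z)"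
    using holomorphic_convex_primitive'[OF V(2,1) hol(1)] at_within_open[OF _ V(1)] by metis
  obtain W where W: "\<And>z. z \<in> V \<Longrightarrow> (W has_field_derivative H z) (at z)"
    using holomorphic_convex_primitive'[OF V(2,1) hol(2)] at_within_open[OF _ V(1)] by metis
  have ZW: "Z holomorphic_on V" "W holomorphic_on V"
    using Z W V(1) by (auto simp: holomorphic_on_open)
  have dZ: "deriv Z z = F z" and dW: "deriv W z = H z" if "z \<in> V" for z
    using Z[OF that] W[OF that] by (auto intro: DERIV_imp_deriv)
  have ddZ: "deriv (deriv Z) z = lin_coeff \<Gamma> c z * F z + cnj (anti_coeff \<Gamma> c z) * cnj (F z)"
   and ddW: "deriv (deriv W) z = lin_coeff \<Gamma> c z * H z + cnj (anti_coeff \<Gamma> c z) * cnj (H z)" if z: "z \<in> V" for z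
  proof -
    have "(deriv Z has_field_derivative (lin_coeff \<Gamma> c z * F z + cnj (anti_coeff \<Gamma> c z) * cnj (F z))) (at z)"
      using F[OF z] by (rule has_field_derivative_transform_within_open[OF _ V(1) z]) (simp add: dZ)
    then show "deriv (deriv Z) z = lin_coeff \<Gamma> c z * F z + cnj (anti_coeff \<Gamma> c z) * cnj (F z)"
      by (rule DERIV_imp_deriv)
    have "(deriv W has_field_derivative (lin_coeff \<Gamma> c z * H z + cnj (anti_coeff \<Gamma> c z) * cnj (H z))) (at z)"
      using H[OF z] by (rule has_field_derivative_transform_within_open[OF _ V(1) z]) (simp add: dW)
    then show "deriv (deriv W) z = lin_coeff \<Gamma> c z * H z + cnj (anti_coeff \<Gamma> c z) * cnj (H z)"
      by (rule DERIV_imp_deriv)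
  qed
  have \<rho>pos: "g c z 1 1 > 0" if "z \<in> chart_image c" for z
    by (rule kaehler_metric_conformal(2)[OF km c that])
  have wedge: "g c z 1 1 = Im (cnj (F z) * H z)" if z: "z \<in> V" for z
  proof -
    have "\<exists>k. \<forall>w\<in>V. Im (cnj (F w) * H w) / g c w 1 1 = k"
    proof (rule has_derivative_zero_constant[OF V(2)])
      fix w assume w: "w \<in> V"
      show "((\<lambda>w. Im (cnj (F w) * H w) / g c w 1 1) has_derivative (\<lambda>u. 0)) (at w within V)"
        using parallel_wedge_derivative[OF sk c subsetD[OF V(4) w] F[OF w] H[OF w]]
        by (rule has_derivative_at_withinI)
    qed
    then have "Im (cnj (F z) * H z) / g c z 1 1 = Im (cnj (F z0) * H z0) / g c z0 1 1"
      using z V(3) by metis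
    also have "\<dots> = 1" using \<rho>pos[OF z0] by (simp add: F0 H0 \<rho>0_def)
    finally show ?thesis using \<rho>pos[of z] z V(4) by (auto simp: field_simps)
  qed
  have "conj_special_coords g \<Gamma> c V Z W"
    unfolding conj_special_coords_def Re_d_wedge
    using V(1,4) ZW parallel_form1_Re_d_iff[OF sk c V(1,4) ZW(1)] parallel_form1_Re_d_iff[OF sk c V(1,4) ZW(2)]
    by (auto simp: dZ dW ddZ ddW kaehler_form_conformal[OF km c subsetD[OF V(4)]] wedge)
  with V(3) that show ?thesis by blast
qed

text \<open>Special coordinates exist near z and all of them give the same value, so the definite
  description denotes it.\<close>

lemma cubic_form_eq:
  assumes sk: "special_kaehler A g \<Gamma>" and c: "c \<in> A" and op: "open (chart_image c)"
    and z: "z \<in> chart_image c"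
  shows "cubic_form A g \<Gamma> c z = - \<i> / 2 * cubic_coeff g \<Gamma> c z"
proof -
  obtain V Z W where "conj_special_coords g \<Gamma> c V Z W" "z \<in> V"
    using conj_special_coords_exist[OF assms] .
  then have "(THE x. \<exists>V Z W. conj_special_coords g \<Gamma> c V Z W \<and> z \<in> V \<and>
      x = 1 / 4 * (deriv (\<lambda>w. deriv W w / deriv Z w) z / deriv Z z) * deriv Z z ^ 3)
    = - \<i> / 2 * cubic_coeff g \<Gamma> c z"
    using conj_special_coords_cubic[OF sk c] by (intro the_equality) metis+
  then show ?thesis using c z by (simp add: cubic_form_def)
qed

section \<open>Change of charts\<close>

lemma riemann_surface_chart:
  assumes "riemann_surface S A" "c \<in> A"
  shows "chart_on S c" "open (chart_image c)" "openin S (fst c)"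
proof -
  show "chart_on S c" using assms unfolding riemann_surface_def by blast
  then show "open (chart_image c)" "openin S (fst c)" by (simp_all add: chart_on_def)
qed

lemma chart_on_inj: "chart_on S c \<Longrightarrow> inj_on (snd c) (fst c)"
  using homeomorphic_imp_injective_map[of "subtopology S (fst c)" "top_of_set (chart_image c)" "snd c"]
  by (simp add: chart_on_def openin_subset inf_absorb2)

lemma chart_on_open_image:
  assumes "chart_on S c" "openin S U" "U \<subseteq> fst c"
  shows "open (snd c ` U)"
proof -
  have "open_map (subtopology S (fst c)) (top_of_set (chart_image c)) (snd c)"
    using assms(1) homeomorphic_imp_open_map unfolding chart_on_def by blast
  moreover have "openin (subtopology S (fst c)) U"
    using assms unfolding chart_on_def by (simp add: openin_open_subtopology)
  ultimately have "openin (top_of_set (chart_image c)) (snd c ` U)"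
    unfolding open_map_def by blast
  then show ?thesis using assms(1) openin_open_trans unfolding chart_on_def by blast
qed

lemma chart_on_open_preimage:
  assumes "chart_on S c" "open B" "B \<subseteq> chart_image c"
  shows "openin S {x \<in> fst c. snd c x \<in> B}"
proof -
  have o: "openin S (fst c)" using assms(1) by (simp add: chart_on_def)
  have "continuous_map (subtopology S (fst c)) (top_of_set (chart_image c)) (snd c)"
    using assms(1) homeomorphic_imp_continuous_map unfolding chart_on_def by blast
  moreover have "openin (top_of_set (chart_image c)) B"
    using assms(2,3) by (simp add: open_subset)
  ultimately have "openin (subtopology S (fst c)) {x \<in> topspace (subtopology S (fst c)). snd c x \<in> B}"
    by (rule openin_continuous_map_preimage)
  moreover have "topspace (subtopology S (fst c)) = fst c"
    using openin_subset[OF o] by auto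
  ultimately have "openin (subtopology S (fst c)) {x \<in> fst c. snd c x \<in> B}" by (simp only:)
  then show ?thesis by (rule openin_trans_full[OF _ o])
qed

lemma overlap_open:
  assumes "riemann_surface S A" "c \<in> A" "d \<in> A"
  shows "open (overlap c d)"
  unfolding overlap_def
  by (rule chart_on_open_image[OF riemann_surface_chart(1)[OF assms(1,2)]])
     (auto intro!: openin_Int riemann_surface_chart(3)[OF assms(1)] assms)

lemma overlap_subset: "overlap c d \<subseteq> chart_image c"
  by (auto simp: overlap_def chart_image_def)

lemma transition_chart:
  assumes "chart_on S c" "x \<in> fst c"
  shows "transition c d (snd c x) = snd d x"
  using chart_on_inj[OF assms(1)] assms(2) by (simp add: transition_def)

lemma transition_overlap:
  assumes "chart_on S c" "chart_on S d" "z \<in> overlap c d"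
  shows "transition c d z \<in> overlap d c" "transition d c (transition c d z) = z"
proof -
  obtain x where x: "x \<in> fst c" "x \<in> fst d" "z = snd c x"
    using assms(3) by (auto simp: overlap_def)
  with transition_chart[OF assms(1) x(1)] transition_chart[OF assms(2) x(2)]
  show "transition c d z \<in> overlap d c" "transition d c (transition c d z) = z"
    by (auto simp: overlap_def)
qed

section \<open>Transformation laws on overlaps\<close>

text \<open>A change of charts adds to the Christoffel tensor a second-derivative term that is
  complex-linear in v, so it affects a but not b. Comparing antilinear parts gives a tensorial law
  for b.\<close>

lemma anti_coeff_transition:
  assumes RS: "riemann_surface S A" and sk: "special_kaehler A g \<Gamma>"
    and c: "c \<in> A" and d: "d \<in> A" and z: "z \<in> overlap c d"
  defines "\<phi> \<equiv> transition c d"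
  shows "anti_coeff \<Gamma> d (\<phi> z) * (cnj (deriv \<phi> z))\<^sup>2 = deriv \<phi> z * anti_coeff \<Gamma> c z"
proof -
  note cc = riemann_surface_chart(1)[OF RS c] and dd = riemann_surface_chart(1)[OF RS d]
  note ocd = overlap_open[OF RS c d] and odc = overlap_open[OF RS d c]
  define \<psi> where "\<psi> = transition d c"
  have hol: "\<phi> holomorphic_on overlap c d" "\<psi> holomorphic_on overlap d c"
    using RS c d unfolding riemann_surface_def \<phi>_def \<psi>_def by blast+
  \<comment> \<open>In the chart d, the constant fields 1 and v of the chart c become J and J
    v.\<close>
  define J where "J w = deriv \<phi> (\<psi> w)" for w
  have "(deriv \<phi> \<circ> \<psi>) holomorphic_on overlap d c"
    by (rule holomorphic_on_compose_gen[OF hol(2) holomorphic_deriv[OF hol(1) ocd]])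
       (use transition_overlap(1)[OF dd cc] in \<open>auto simp: \<psi>_def\<close>)
  then have J: "J holomorphic_on overlap d c" by (simp add: J_def[abs_def] o_def)
  have Jv: "(\<lambda>w. J w * v) holomorphic_on overlap d c" for v
    by (intro holomorphic_intros J)
  have J\<phi>: "J (\<phi> w) = deriv \<phi> w" if "w \<in> overlap c d" for w
    using transition_overlap(2)[OF cc dd that] by (simp add: J_def \<phi>_def \<psi>_def)
  have \<phi>z: "\<phi> z \<in> overlap d c"
    using transition_overlap(1)[OF cc dd z] by (simp add: \<phi>_def)
  have zi: "z \<in> chart_image c" "\<phi> z \<in> chart_image d"
    using z \<phi>z overlap_subset by blast+
  define s where "s = deriv J (\<phi> z)"
  have s: "((\<lambda>w. J w * v) has_field_derivative s * v) (at (\<phi> z))" for v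
    unfolding s_def by (intro DERIV_cmult_right holomorphic_derivI[OF J odc \<phi>z])
  have "tangent_connection A \<Gamma>" using sk by (simp add: special_kaehler_def)
  then have tr: "\<And>X Y X' Y'. smooth_on (overlap c d) X \<and> smooth_on (overlap c d) Y \<and>
      smooth_on (overlap d c) X' \<and> smooth_on (overlap d c) Y' \<and>
      (\<forall>z\<in>overlap c d. X' (\<phi> z) = deriv \<phi> z * X z \<and> Y' (\<phi> z) = deriv \<phi> z * Y z) \<Longrightarrow>
      (\<forall>z\<in>overlap c d. cov_deriv \<Gamma> d X' Y' (\<phi> z) = deriv \<phi> z * cov_deriv \<Gamma> c X Y z)"
    using c d unfolding tangent_connection_def \<phi>_def by blast
  have "cov_deriv \<Gamma> d J (\<lambda>w. J w * v) (\<phi> z) = deriv \<phi> z * cov_deriv \<Gamma> c (\<lambda>w. 1) (\<lambda>w. v) z" for v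
  proof (rule bspec[OF tr z], intro conjI ballI smooth_on_const)
    show "smooth_on (overlap d c) J" "smooth_on (overlap d c) (\<lambda>w. J w * v)"
      by (intro smooth_on_holomorphic odc J Jv)+
  qed (simp_all add: J\<phi>)
  then have E: "s * v * deriv \<phi> z + \<Gamma> d (\<phi> z) (deriv \<phi> z) (deriv \<phi> z * v) = deriv \<phi> z * \<Gamma> c z 1 v" for v
    by (simp add: cov_deriv_def[of \<Gamma> d] dir_deriv_def frechet_derivative_field[OF s] J\<phi>[OF z])
  note G = special_kaehler_christoffel[OF sk c zi(1)] special_kaehler_christoffel[OF sk d zi(2)]
  \<comment> \<open>T collects the complex-linear part with the inhomogeneous term; v = 1 and v = i
    yield T + B and T - B, which isolates B.\<close>
  define T where "T = s * deriv \<phi> z + lin_coeff \<Gamma> d (\<phi> z) * (deriv \<phi> z)\<^sup>2"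
  define B where "B = anti_coeff \<Gamma> d (\<phi> z) * (cnj (deriv \<phi> z))\<^sup>2"
  define a where "a = deriv \<phi> z * lin_coeff \<Gamma> c z"
  define b where "b = deriv \<phi> z * anti_coeff \<Gamma> c z"
  have "T + B = a + b"
    using E[of 1] unfolding G T_def B_def a_def b_def by (simp add: algebra_simps power2_eq_square)
  moreover have "\<i> * (T - B) = \<i> * (a - b)"
    using E[of \<i>] unfolding G T_def B_def a_def b_def by (simp add: algebra_simps power2_eq_square)
  then have "T - B = a - b" by simp
  moreover have "2 * B = (T + B) - (T - B)" "2 * b = (a + b) - (a - b)" by simp_all
  ultimately have "2 * B = 2 * b" by (simp only:)
  then have "B = b" by simp
  then show ?thesis unfolding B_def b_def .
qed

lemma conformal_factor_transition:
  assumes km: "kaehler_metric A g" and c: "c \<in> A" and d: "d \<in> A" and z: "z \<in> overlap c d"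
    and \<phi>z: "transition c d z \<in> chart_image d"
  shows "complex_of_real (g c z 1 1) =
    of_real (g d (transition c d z) 1 1) * (deriv (transition c d) z * cnj (deriv (transition c d) z))"
proof -
  have "g c z 1 1 = g d (transition c d z) (deriv (transition c d) z * 1) (deriv (transition c d) z * 1)"
    using km c d z unfolding kaehler_metric_def by metis
  also have "\<dots> = g d (transition c d z) 1 1 * Re (deriv (transition c d) z * cnj (deriv (transition c d) z))"
    by (subst kaehler_metric_conformal(1)[OF km d \<phi>z]) simp
  finally show ?thesis by (simp add: complex_eq_iff)
qed

text \<open>The metric contributes p cnj p, and the conjugated law for b contributes p^2 / cnj p,
  which makes p^3 in total. That p is nonzero follows from \<rho> > 0.\<close>

lemma cubic_coeff_transition:
  assumes RS: "riemann_surface S A" and sk: "special_kaehler A g \<Gamma>"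
    and c: "c \<in> A" and d: "d \<in> A" and z: "z \<in> overlap c d"
  shows "deriv (transition c d) z \<noteq> 0"
    and "cubic_coeff g \<Gamma> c z = cubic_coeff g \<Gamma> d (transition c d z) * deriv (transition c d) z ^ 3"
proof -
  note cc = riemann_surface_chart(1)[OF RS c] and dd = riemann_surface_chart(1)[OF RS d]
  have km: "kaehler_metric A g" using sk by (simp add: special_kaehler_def)
  have zi: "z \<in> chart_image c" "transition c d z \<in> chart_image d"
    using z transition_overlap(1)[OF cc dd z] overlap_subset by blast+
  define p where "p = deriv (transition c d) z"
  have \<rho>: "complex_of_real (g c z 1 1) = of_real (g d (transition c d z) 1 1) * (p * cnj p)"
    unfolding p_def by (rule conformal_factor_transition[OF km c d z zi(2)])
  then have p: "p \<noteq> 0" using kaehler_metric_conformal(2)[OF km c zi(1)] by auto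
  then show "deriv (transition c d) z \<noteq> 0" by (simp add: p_def)
  have "cnj (anti_coeff \<Gamma> d (transition c d z) * (cnj p)\<^sup>2) = cnj (p * anti_coeff \<Gamma> c z)"
    unfolding p_def by (rule arg_cong[OF anti_coeff_transition[OF RS sk c d z]])
  then have "cubic_coeff g \<Gamma> c z * cnj p = (cubic_coeff g \<Gamma> d (transition c d z) * p ^ 3) * cnj p"
    unfolding cubic_coeff_def \<rho> by (simp add: algebra_simps power2_eq_square power3_eq_cube)
  then show "cubic_coeff g \<Gamma> c z = cubic_coeff g \<Gamma> d (transition c d z) * deriv (transition c d) z ^ 3"
    using p by (simp add: p_def)
qed

text \<open>By \<open>tr\<close>, vanishing at a point does not depend on the chart. The interior of
  the zero set is open, closed by analytic continuation in coordinate discs, and nonempty because of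
  \<open>U\<close>, so connectedness makes it the whole surface.\<close>

lemma riemann_surface_identity_theorem:
  assumes RS: "riemann_surface S A"
    and hol: "\<And>c. c \<in> A \<Longrightarrow> h c holomorphic_on chart_image c"
    and tr: "\<And>c d z. c \<in> A \<Longrightarrow> d \<in> A \<Longrightarrow> z \<in> overlap c d \<Longrightarrow> h c z = 0 \<Longrightarrow> h d (transition c d z) = 0"
    and c0: "c0 \<in> A" and U: "open U" "U \<noteq> {}" "U \<subseteq> chart_image c0" "\<And>z. z \<in> U \<Longrightarrow> h c0 z = 0"
    and c: "c \<in> A" and z: "z \<in> chart_image c"
  shows "h c z = 0"
proof -
  note chart = riemann_surface_chart[OF RS]
  define N where "N = {x \<in> topspace S. \<forall>c\<in>A. x \<in> fst c \<longrightarrow> h c (snd c x) = 0}"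
  define P where "P = S interior_of N"
  have N: "x \<in> N" if "c \<in> A" "x \<in> fst c" "h c (snd c x) = 0" for c x
  proof -
    have "h d (snd d x) = 0" if d: "d \<in> A" "x \<in> fst d" for d
      using tr[of c d "snd c x"] transition_chart[OF chart(1)] d \<open>c \<in> A\<close> \<open>x \<in> fst c\<close> \<open>h c (snd c x) = 0\<close>
      by (auto simp: overlap_def)
    moreover have "x \<in> topspace S" using openin_subset[OF chart(3)] that by blast
    ultimately show ?thesis by (simp add: N_def)
  qed
  have PN: "P \<subseteq> N" and Po: "openin S P" by (simp_all add: P_def interior_of_subset)
  have "openin S (topspace S - P)"
  proof (subst openin_subopen, intro ballI)
    fix x assume x: "x \<in> topspace S - P"
    then have "x \<in> \<Union>(fst ` A)" using RS unfolding riemann_surface_def by blast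
    then obtain c where c: "c \<in> A" "x \<in> fst c" by blast
    then have "snd c x \<in> chart_image c" by (simp add: chart_image_def)
    then obtain e where e: "e > 0" "ball (snd c x) e \<subseteq> chart_image c"
      using chart(2)[OF c(1)] openE by blast
    define T where "T = {y \<in> fst c. snd c y \<in> ball (snd c x) e}"
    have T: "openin S T" unfolding T_def by (rule chart_on_open_preimage[OF chart(1)[OF c(1)] open_ball e(2)])
    \<comment> \<open>If the disc around x met P, then \<open>h c\<close> would vanish on a nonempty
      open part of it, hence on the whole disc, and x would lie in P.\<close>
    have "T \<inter> P = {}"
    proof (rule ccontr)
      assume ne: "T \<inter> P \<noteq> {}"
      define U' where "U' = snd c ` (T \<inter> P)"
      have U': "open U'" "U' \<noteq> {}" "U' \<subseteq> ball (snd c x) e"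
        unfolding U'_def using ne T Po
        by (auto intro!: chart_on_open_image[OF chart(1)[OF c(1)]] simp: T_def)
      have zero: "h c w = 0" if "w \<in> U'" for w
        using that PN c unfolding U'_def N_def T_def by auto
      have "h c w = 0" if "w \<in> ball (snd c x) e" for w
        by (rule analytic_continuation_open[OF U'(1) open_ball U'(2) connected_ball U'(3), of "h c" "\<lambda>_. 0"])
           (use zero that holomorphic_on_subset[OF hol[OF c(1)] e(2)] in auto)
      then have "T \<subseteq> N" using N[OF c(1)] by (auto simp: T_def)
      then have "T \<subseteq> P" unfolding P_def by (rule interior_of_maximal[OF _ T])
      moreover have "x \<in> T" using c e by (simp add: T_def)
      ultimately show False using x by blast
    qed
    then have "T \<subseteq> topspace S - P" using openin_subset[OF T] by blast
    moreover have "x \<in> T" using c e by (simp add: T_def)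
    ultimately show "\<exists>T. openin S T \<and> x \<in> T \<and> T \<subseteq> topspace S - P" using T by blast
  qed
  then have "closedin S P" using openin_subset[OF Po] by (simp add: closedin_def)
  moreover have "connected_space S" using RS by (simp add: riemann_surface_def)
  ultimately have "P = {} \<or> P = topspace S" using Po connected_space_clopen_in by blast
  moreover have "P \<noteq> {}"
  proof -
    define T where "T = {y \<in> fst c0. snd c0 y \<in> U}"
    have "openin S T" unfolding T_def by (rule chart_on_open_preimage[OF chart(1)[OF c0] U(1,3)])
    moreover have "T \<subseteq> N" using N[OF c0] U(4) by (auto simp: T_def)
    ultimately have "T \<subseteq> P" unfolding P_def by (simp add: interior_of_maximal)
    moreover have "T \<noteq> {}" using U(2,3) by (auto simp: T_def chart_image_def)
    ultimately show ?thesis by blast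
  qed
  ultimately have "P = topspace S" by blast
  moreover obtain x where "x \<in> fst c" "z = snd c x" using z by (auto simp: chart_image_def)
  moreover have "x \<in> topspace S" using openin_subset[OF chart(3)[OF c]] \<open>x \<in> fst c\<close> by blast
  ultimately show ?thesis using PN c by (auto simp: N_def)
qed

section \<open>Rotating the connection\<close>

text \<open>For a unit \<mu>, \<open>cnj \<mu>\<close> is the inverse, so this is conjugation by
  \<mu>; as \<mu> is constant, no derivative of it enters.\<close>

definition rotate_connection :: "complex \<Rightarrow> 'a connection \<Rightarrow> 'a connection" where
  "rotate_connection \<mu> \<Gamma> c z u v = cnj \<mu> * \<Gamma> c z u (\<mu> * v)"

lemma cnj_mult_unit:
  assumes "cmod \<mu> = 1"
  shows "cnj \<mu> * \<mu> = 1"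
  using complex_norm_square[of \<mu>] assms by (simp add: mult.commute)

lemma dir_deriv_mult_left:
  fixes Y :: vfield
  assumes "Y differentiable (at z)"
  shows "dir_deriv X (\<lambda>w. \<mu> * Y w) z = \<mu> * dir_deriv X Y z"
proof -
  have "((\<lambda>w. \<mu> * Y w) has_derivative (\<lambda>u. \<mu> * frechet_derivative Y (at z) u)) (at z)"
    using assms by (intro bounded_linear.has_derivative[OF bounded_linear_mult_right]) (simp add: frechet_derivative_works)
  from frechet_derivative_at[OF this, symmetric] show ?thesis by (simp add: dir_deriv_def)
qed

lemma smooth_on_differentiable: "smooth_on S f \<Longrightarrow> z \<in> S \<Longrightarrow> f differentiable (at z)"
  using smooth_on_has_derivative by (auto simp: differentiable_def)

lemma smooth_on_mult_left: "open S \<Longrightarrow> smooth_on S f \<Longrightarrow> smooth_on S (\<lambda>z. \<mu> * f z :: complex)"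
  by (rule smooth_on_bounded_linear[OF _ bounded_linear_mult_right])

text \<open>Thus \<open>rotate_connection \<mu> \<Gamma>\<close> is the gauge transform of \<open>\<nabla>\<close> by the constant
  endomorphism \<open>\<mu>\<close>, and it inherits flatness.\<close>

lemma cov_deriv_rotate:
  assumes "cmod \<mu> = 1" "Y differentiable (at z)"
  shows "cov_deriv (rotate_connection \<mu> \<Gamma>) c X Y z = cnj \<mu> * cov_deriv \<Gamma> c X (\<lambda>w. \<mu> * Y w) z"
proof -
  have "cnj \<mu> * \<mu> = 1" by (rule cnj_mult_unit[OF assms(1)])
  then show ?thesis
    unfolding cov_deriv_def dir_deriv_mult_left[OF assms(2)] rotate_connection_def
    by (simp add: distrib_left mult.assoc[symmetric])
qed

text \<open>Needed to differentiate iterated covariant derivatives. The definition of smoothness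
  controls derivatives in fixed directions, so the derivative along the varying X is first expanded
  in the directions 1 and i.\<close>

lemma cov_deriv_differentiable:
  assumes sk: "special_kaehler A g \<Gamma>" and c: "c \<in> A" and op: "open (chart_image c)"
    and X: "smooth_on (chart_image c) X" and Y: "smooth_on (chart_image c) Y" and z: "z \<in> chart_image c"
  shows "cov_deriv \<Gamma> c X Y differentiable (at z)"
proof -
  have Y2: "Ck_on (Suc (Suc 0)) (chart_image c) Y" using Y by (simp only: smooth_on_def)
  have dY: "(\<lambda>w. frechet_derivative Y (at w) v) differentiable (at z)" for v
    using Y2 z by simp
  have dX: "X differentiable (at z)" and dYz: "Y differentiable (at z)"
    using smooth_on_differentiable[OF X z] smooth_on_differentiable[OF Y z] .
  obtain ap aq bp bq where
    "wirtinger_C1 (chart_image c) (lin_coeff \<Gamma> c) ap aq" "wirtinger_C1 (chart_image c) (anti_coeff \<Gamma> c) bp bq"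
    using special_kaehler_coeffs[OF sk c] by metis
  then have da: "lin_coeff \<Gamma> c differentiable (at z)" and db: "anti_coeff \<Gamma> c differentiable (at z)"
    using wirtinger_C1_D[OF _ z] unfolding differentiable_def by blast+
  have bl: "(\<lambda>w. L (f w)) differentiable (at z)" if "bounded_linear L" "f differentiable (at z)"
    for L :: "complex \<Rightarrow> complex" and f
    using that bounded_linear.has_derivative unfolding differentiable_def by blast
  define H where "H w = of_real (Re (X w)) * frechet_derivative Y (at w) 1 + of_real (Im (X w)) * frechet_derivative Y (at w) \<i>
        + (lin_coeff \<Gamma> c w * X w * Y w + anti_coeff \<Gamma> c w * cnj (X w) * cnj (Y w))" for w
  have dH: "H differentiable (at z)"
    unfolding H_def
    by (intro differentiable_add differentiable_mult da db dX dYz dY bl[OF bounded_linear_cnj]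
        bl[OF bounded_linear_compose[OF bounded_linear_of_real bounded_linear_Re]]
        bl[OF bounded_linear_compose[OF bounded_linear_of_real bounded_linear_Im]])
  have eq: "H w = cov_deriv \<Gamma> c X Y w" if w: "w \<in> chart_image c" for w
  proof -
    interpret linear "frechet_derivative Y (at w)"
      by (rule linear_frechet_derivative[OF smooth_on_differentiable[OF Y w]])
    have "X w = Re (X w) *\<^sub>R 1 + Im (X w) *\<^sub>R \<i>"
      by (metis complex_eq mult.commute scaleR_conv_of_real mult.right_neutral)
    then have "frechet_derivative Y (at w) (X w)
        = frechet_derivative Y (at w) (Re (X w) *\<^sub>R 1 + Im (X w) *\<^sub>R \<i>)" by (rule arg_cong)
    also have "\<dots> = of_real (Re (X w)) * frechet_derivative Y (at w) 1 + of_real (Im (X w)) * frechet_derivative Y (at w) \<i>"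
      by (simp only: add scaleR) (simp add: scaleR_conv_of_real)
    finally show ?thesis
      unfolding H_def cov_deriv_def dir_deriv_def special_kaehler_christoffel[OF sk c w] by simp
  qed
  obtain D where "(H has_derivative D) (at z)" using dH by (auto simp: differentiable_def)
  then have "(cov_deriv \<Gamma> c X Y has_derivative D) (at z)"
    by (rule has_derivative_transform_within_open[OF _ op z]) (rule eq)
  then show ?thesis by (auto simp: differentiable_def)
qed

text \<open>In the complex-linear term \<mu> cancels; in the antilinear term it gets conjugated and
  supplies a second factor \<open>cnj \<mu>\<close>.\<close>

lemma rotate_connection_christoffel:
  assumes sk: "special_kaehler A g \<Gamma>" and c: "c \<in> A" and \<mu>: "cmod \<mu> = 1" and z: "z \<in> chart_image c"
  shows "rotate_connection \<mu> \<Gamma> c z u v = lin_coeff \<Gamma> c z * u * v + ((cnj \<mu>)\<^sup>2 * anti_coeff \<Gamma> c z) * cnj u * cnj v"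
proof -
  have "cnj \<mu> * \<mu> = 1" by (rule cnj_mult_unit[OF \<mu>])
  then have "cnj \<mu> * (\<mu> * x) = x" for x by (simp add: mult.assoc[symmetric])
  then show ?thesis
    unfolding rotate_connection_def special_kaehler_christoffel[OF sk c z]
    by (simp add: algebra_simps power2_eq_square)
qed

lemma kaehler_form_rotate:
  assumes km: "kaehler_metric A g" and c: "c \<in> A" and \<mu>: "cmod \<mu> = 1"
  shows "kaehler_form g c z (\<mu> * u) (\<mu> * v) = kaehler_form g c z u v"
proof (cases "z \<in> chart_image c")
  case True
  have "cnj \<mu> * \<mu> = 1" by (rule cnj_mult_unit[OF \<mu>])
  then have "cnj (\<mu> * u) * (\<mu> * v) = cnj u * v" by (simp add: mult_ac)
  then show ?thesis using kaehler_form_conformal[OF km c True] by (simp only:)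
next
  case False
  then have "g c z u v = 0" for u v using km unfolding kaehler_metric_def by blast
  then show ?thesis by (simp add: kaehler_form_def)
qed

text \<open>Chart independence holds because \<mu> commutes with the derivatives of transition maps.
  Flatness and \<nabla>\<omega> = 0 survive conjugation by \<mu>, which preserves \<omega>. The
  torsion and the condition on I are read off from the Christoffel tensor, whose normal form is
  kept.\<close>

lemma special_kaehler_rotate:
  assumes RS: "riemann_surface S A" and sk: "special_kaehler A g \<Gamma>" and \<mu>: "cmod \<mu> = 1"
  shows "special_kaehler A g (rotate_connection \<mu> \<Gamma>)"
proof -
  have km: "kaehler_metric A g" and tc: "tangent_connection A \<Gamma>" and fc: "flat_connection A \<Gamma>"
    and p2: "parallel_form2 A \<Gamma> (kaehler_form g)"
    using sk by (simp_all add: special_kaehler_def)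
  note op = riemann_surface_chart(2)[OF RS]
  have \<mu>1: "\<mu> * (cnj \<mu> * x) = x" for x
  proof -
    have "\<mu> * cnj \<mu> = 1" using cnj_mult_unit[OF \<mu>] by (simp add: mult.commute)
    then show ?thesis by (simp add: mult.assoc[symmetric])
  qed
  let ?R = "rotate_connection \<mu> \<Gamma>"
  have "tangent_connection A ?R"
    unfolding tangent_connection_def
  proof (intro conjI allI ballI impI)
    fix c z u v assume "c \<notin> A \<or> z \<notin> chart_image c"
    then show "?R c z u v = 0"
      using christoffel_coeffs_outside(3)[OF tc] by (simp add: rotate_connection_def)
  next
    fix c u v assume c: "c \<in> A"
    then have "smooth_on (chart_image c) (\<lambda>z. \<Gamma> c z u (\<mu> * v))"
      using tc unfolding tangent_connection_def by blast
    then show "smooth_on (chart_image c) (\<lambda>z. ?R c z u v)"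
      unfolding rotate_connection_def by (rule smooth_on_mult_left[OF op[OF c]])
  next
    fix c z assume c: "c \<in> A" and z: "z \<in> chart_image c"
    show "bilinear (?R c z)"
      unfolding bilinear_def linear_iff rotate_connection_christoffel[OF sk c \<mu> z]
      by (simp add: algebra_simps)
  next
    fix c d z and X Y X' Y' :: vfield
    assume c: "c \<in> A" and d: "d \<in> A" and z: "z \<in> overlap c d"
      and XY: "smooth_on (overlap c d) X \<and> smooth_on (overlap c d) Y \<and>
        smooth_on (overlap d c) X' \<and> smooth_on (overlap d c) Y' \<and>
        (\<forall>z\<in>overlap c d. X' (transition c d z) = deriv (transition c d) z * X z \<and>
                          Y' (transition c d z) = deriv (transition c d) z * Y z)"
    have \<phi>z: "transition c d z \<in> overlap d c"
      by (rule transition_overlap(1)[OF riemann_surface_chart(1)[OF RS c] riemann_surface_chart(1)[OF RS d] z])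
    have dY: "Y differentiable (at z)" "Y' differentiable (at (transition c d z))"
      using XY z \<phi>z smooth_on_differentiable by blast+
    have XY2: "smooth_on (overlap c d) X \<and> smooth_on (overlap c d) (\<lambda>w. \<mu> * Y w) \<and>
        smooth_on (overlap d c) X' \<and> smooth_on (overlap d c) (\<lambda>w. \<mu> * Y' w) \<and>
        (\<forall>z\<in>overlap c d. X' (transition c d z) = deriv (transition c d) z * X z \<and>
              \<mu> * Y' (transition c d z) = deriv (transition c d) z * (\<mu> * Y z))"
      using XY smooth_on_mult_left[OF overlap_open[OF RS c d]] smooth_on_mult_left[OF overlap_open[OF RS d c]]
      by simp
    have "cov_deriv \<Gamma> d X' (\<lambda>w. \<mu> * Y' w) (transition c d z)
        = deriv (transition c d) z * cov_deriv \<Gamma> c X (\<lambda>w. \<mu> * Y w) z"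
      using tc[unfolded tangent_connection_def, THEN conjunct2, THEN conjunct2, rule_format, OF c d XY2 z] .
    then show "cov_deriv ?R d X' Y' (transition c d z) = deriv (transition c d) z * cov_deriv ?R c X Y z"
      unfolding cov_deriv_rotate[OF \<mu> dY(1)] cov_deriv_rotate[OF \<mu> dY(2)] by simp
  qed
  moreover have "flat_connection A ?R"
    unfolding flat_connection_def
  proof (intro ballI allI impI)
    fix c z and X Y V :: vfield
    assume c: "c \<in> A" and z: "z \<in> chart_image c"
      and XYV: "smooth_on (chart_image c) X \<and> smooth_on (chart_image c) Y \<and> smooth_on (chart_image c) V"
    have \<mu>V: "smooth_on (chart_image c) (\<lambda>w. \<mu> * V w)"
      using XYV smooth_on_mult_left[OF op[OF c]] by blast
    have dV: "V differentiable (at w)" if "w \<in> chart_image c" for w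
      using XYV that smooth_on_differentiable by blast
    \<comment> \<open>The inner derivative equals \<open>cnj \<mu> * T\<close> on the whole chart
      image and so can be differentiated. The \<mu> of the outer rotation cancels against this
      factor, and a single \<open>cnj \<mu>\<close> is left in front.\<close>
    have twice: "cov_deriv ?R c X (cov_deriv ?R c Y V) z
        = cnj \<mu> * cov_deriv \<Gamma> c X (cov_deriv \<Gamma> c Y (\<lambda>w. \<mu> * V w)) z"
      if Y: "smooth_on (chart_image c) Y" for X Y
    proof -
      define T where "T = cov_deriv \<Gamma> c Y (\<lambda>w. \<mu> * V w)"
      have dT: "T differentiable (at z)"
        unfolding T_def by (rule cov_deriv_differentiable[OF sk c op[OF c] Y \<mu>V z])
      have eq: "cnj \<mu> * T w = cov_deriv ?R c Y V w" if "w \<in> chart_image c" for w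
        unfolding T_def by (rule cov_deriv_rotate[OF \<mu> dV[OF that], symmetric])
      have "(\<lambda>w. cnj \<mu> * T w) differentiable (at z)" using dT by (intro differentiable_mult) auto
      from frechet_derivative_transform_within_open[OF this op[OF c] z eq]
      have "dir_deriv X (cov_deriv ?R c Y V) z = dir_deriv X (\<lambda>w. cnj \<mu> * T w) z"
        by (simp add: dir_deriv_def)
      moreover have "cov_deriv ?R c X (cov_deriv ?R c Y V) z
          = dir_deriv X (cov_deriv ?R c Y V) z + ?R c z (X z) (cnj \<mu> * T z)"
        unfolding eq[OF z] by (simp add: cov_deriv_def[of ?R c X])
      ultimately have "cov_deriv ?R c X (cov_deriv ?R c Y V) z = cnj \<mu> * cov_deriv \<Gamma> c X T z"
        by (simp add: dir_deriv_mult_left[OF dT] \<mu>1 distrib_left cov_deriv_def[of \<Gamma> c X]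
            rotate_connection_def[of \<mu> \<Gamma> c z])
      then show ?thesis unfolding T_def .
    qed
    have "cov_deriv \<Gamma> c X (cov_deriv \<Gamma> c Y (\<lambda>w. \<mu> * V w)) z
        - cov_deriv \<Gamma> c Y (cov_deriv \<Gamma> c X (\<lambda>w. \<mu> * V w)) z
        - cov_deriv \<Gamma> c (lie_bracket X Y) (\<lambda>w. \<mu> * V w) z = 0"
      using fc c z XYV \<mu>V unfolding flat_connection_def by blast
    then show "cov_deriv ?R c X (cov_deriv ?R c Y V) z - cov_deriv ?R c Y (cov_deriv ?R c X V) z
        - cov_deriv ?R c (lie_bracket X Y) V z = 0"
      using XYV by (simp add: twice cov_deriv_rotate[OF \<mu> dV[OF z]] right_diff_distrib[symmetric])
  qed
  moreover have "torsion_free A ?R"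
    unfolding torsion_free_def cov_deriv_def lie_bracket_def
    by (simp add: rotate_connection_christoffel[OF sk _ \<mu>] mult_ac)
  moreover have "parallel_form2 A ?R (kaehler_form g)"
    unfolding parallel_form2_def
  proof (intro ballI allI impI)
    fix c z and X Y V :: vfield
    assume c: "c \<in> A" and z: "z \<in> chart_image c"
      and XYV: "smooth_on (chart_image c) X \<and> smooth_on (chart_image c) Y \<and> smooth_on (chart_image c) V"
    have sm: "smooth_on (chart_image c) (\<lambda>w. \<mu> * Y w)" "smooth_on (chart_image c) (\<lambda>w. \<mu> * V w)"
      using XYV smooth_on_mult_left[OF op[OF c]] by blast+
    have d: "Y differentiable (at z)" "V differentiable (at z)"
      using XYV z smooth_on_differentiable by blast+
    note rot = kaehler_form_rotate[OF km c \<mu>]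
    have "dir_deriv X (\<lambda>w. kaehler_form g c w (\<mu> * Y w) (\<mu> * V w)) z
             - kaehler_form g c z (cov_deriv \<Gamma> c X (\<lambda>w. \<mu> * Y w) z) (\<mu> * V z)
             - kaehler_form g c z (\<mu> * Y z) (cov_deriv \<Gamma> c X (\<lambda>w. \<mu> * V w) z) = 0"
      using p2 c z XYV sm unfolding parallel_form2_def by blast
    \<comment> \<open>Invariance of \<omega> turns a factor \<open>cnj \<mu>\<close> in one slot
      into \<mu> in the other, which matches the rotated covariant derivatives.\<close>
    moreover have "kaehler_form g c z (cnj \<mu> * u) v = kaehler_form g c z u (\<mu> * v)"
      "kaehler_form g c z v (cnj \<mu> * u) = kaehler_form g c z (\<mu> * v) u" for u v
      using rot[of z "cnj \<mu> * u" v] rot[of z v "cnj \<mu> * u"] by (simp_all add: \<mu>1)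
    ultimately show "dir_deriv X (\<lambda>w. kaehler_form g c w (Y w) (V w)) z
             - kaehler_form g c z (cov_deriv ?R c X Y z) (V z)
             - kaehler_form g c z (Y z) (cov_deriv ?R c X V z) = 0"
      by (simp add: rot cov_deriv_rotate[OF \<mu> d(1)] cov_deriv_rotate[OF \<mu> d(2)])
  qed
  moreover have "cov_deriv_I ?R c X Y z = cov_deriv_I ?R c Y X z"
    if c: "c \<in> A" and sm: "smooth_on (chart_image c) X" "smooth_on (chart_image c) Y" and z: "z \<in> chart_image c"
    for c X Y z
    unfolding cov_deriv_I_def cov_deriv_def
      dir_deriv_mult_left[OF smooth_on_differentiable[OF sm(1) z]]
      dir_deriv_mult_left[OF smooth_on_differentiable[OF sm(2) z]]
      rotate_connection_christoffel[OF sk c \<mu> z]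
    by (simp add: algebra_simps)
  ultimately show ?thesis using km unfolding special_kaehler_def by blast
qed

lemma cubic_form_rotate:
  assumes RS: "riemann_surface S A" and sk: "special_kaehler A g \<Gamma>" and \<mu>: "cmod \<mu> = 1"
  shows "cubic_form A g (rotate_connection \<mu> \<Gamma>) = (\<lambda>c z. \<mu>\<^sup>2 * cubic_form A g \<Gamma> c z)"
proof (intro ext)
  fix c z
  show "cubic_form A g (rotate_connection \<mu> \<Gamma>) c z = \<mu>\<^sup>2 * cubic_form A g \<Gamma> c z"
  proof (cases "c \<in> A \<and> z \<in> chart_image c")
    case True
    then have c: "c \<in> A" and z: "z \<in> chart_image c" by auto
    have "anti_coeff (rotate_connection \<mu> \<Gamma>) c z = (cnj \<mu>)\<^sup>2 * anti_coeff \<Gamma> c z"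
      unfolding anti_coeff_def[of "rotate_connection \<mu> \<Gamma>"] rotate_connection_christoffel[OF sk c \<mu> z]
      by (simp add: algebra_simps)
    then show ?thesis
      unfolding cubic_form_eq[OF sk c riemann_surface_chart(2)[OF RS c] z]
        cubic_form_eq[OF special_kaehler_rotate[OF RS sk \<mu>] c riemann_surface_chart(2)[OF RS c] z]
      by (simp add: cubic_coeff_def)
  qed (auto simp: cubic_form_def)
qed

section \<open>Special Kaehler structures with a common metric\<close>

text \<open>The metric fixes a, and the cubic form fixes b because \<rho> > 0; away from the charts
  both tensors are zero by convention.\<close>

lemma special_kaehler_connection_unique:
  assumes RS: "riemann_surface S A" and sk: "special_kaehler A g \<Gamma>" and sk': "special_kaehler A g \<Gamma>'"
    and eq: "cubic_form A g \<Gamma> = cubic_form A g \<Gamma>'"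
  shows "\<Gamma> = \<Gamma>'"
proof (intro ext)
  fix c z u v
  have tc: "tangent_connection A \<Gamma>" "tangent_connection A \<Gamma>'"
    using sk sk' by (simp_all add: special_kaehler_def)
  show "\<Gamma> c z u v = \<Gamma>' c z u v"
  proof (cases "c \<in> A \<and> z \<in> chart_image c")
    case True
    then have c: "c \<in> A" and z: "z \<in> chart_image c" by auto
    have "g c z 1 1 > 0"
      using kaehler_metric_conformal(2)[OF _ c z] sk unfolding special_kaehler_def by blast
    moreover have "cubic_coeff g \<Gamma> c z = cubic_coeff g \<Gamma>' c z"
      using fun_cong[OF fun_cong[OF eq, of c], of z]
      unfolding cubic_form_eq[OF sk c riemann_surface_chart(2)[OF RS c] z]
        cubic_form_eq[OF sk' c riemann_surface_chart(2)[OF RS c] z] by simp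
    ultimately have "anti_coeff \<Gamma> c z = anti_coeff \<Gamma>' c z"
      by (simp add: cubic_coeff_def)
    then show ?thesis
      using lin_coeff_determined_by_metric[OF sk sk' c z]
      by (simp add: special_kaehler_christoffel[OF sk c z] special_kaehler_christoffel[OF sk' c z])
  next
    case False
    then show ?thesis using christoffel_coeffs_outside(3)[OF tc(1)] christoffel_coeffs_outside(3)[OF tc(2)] by metis
  qed
qed

text \<open>The flatness equation \<open>\<partial>a/\<partial>z* = - |b|\<^sup>2\<close> recovers \<open>|b|\<close> from the metric.\<close>

lemma cubic_coeff_norm_determined_by_metric:
  assumes sk: "special_kaehler A g \<Gamma>" and sk': "special_kaehler A g \<Gamma>'" and c: "c \<in> A"
    and op: "open (chart_image c)" and z: "z \<in> chart_image c"
  shows "cmod (cubic_coeff g \<Gamma> c z) = cmod (cubic_coeff g \<Gamma>' c z)"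
proof -
  obtain ap aq bp bq where W: "wirtinger_C1 (chart_image c) (lin_coeff \<Gamma> c) ap aq" and
    aq: "\<And>z. z \<in> chart_image c \<Longrightarrow> aq z = - (anti_coeff \<Gamma> c z * cnj (anti_coeff \<Gamma> c z))"
    using special_kaehler_coeffs[OF sk c] by metis
  obtain ap' aq' bp' bq' where W': "wirtinger_C1 (chart_image c) (lin_coeff \<Gamma>' c) ap' aq'" and
    aq': "\<And>z. z \<in> chart_image c \<Longrightarrow> aq' z = - (anti_coeff \<Gamma>' c z * cnj (anti_coeff \<Gamma>' c z))"
    using special_kaehler_coeffs[OF sk' c] by metis
  \<comment> \<open>The two coefficients a agree on an open set, so their derivatives agree; u = 1
    and u = i then separate the antiholomorphic part.\<close>
  have "(lin_coeff \<Gamma> c has_derivative (\<lambda>u. ap' z * u + aq' z * cnj u)) (at z)"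
    by (rule has_derivative_transform_within_open[OF wirtinger_C1_D[OF W' z] op z])
       (rule lin_coeff_determined_by_metric[OF sk' sk c])
  from has_derivative_unique[OF wirtinger_C1_D[OF W z] this]
  have E: "ap z * u + aq z * cnj u = ap' z * u + aq' z * cnj u" for u by (rule fun_cong)
  have "ap z + aq z = ap' z + aq' z" using E[of 1] by simp
  moreover have "\<i> * (ap z - aq z) = \<i> * (ap' z - aq' z)" using E[of \<i>] by (simp add: algebra_simps)
  then have "ap z - aq z = ap' z - aq' z" by simp
  moreover have "2 * x = (y + x) - (y - x)" for x y :: complex by simp
  ultimately have "2 * aq z = 2 * aq' z" by metis
  then have "anti_coeff \<Gamma> c z * cnj (anti_coeff \<Gamma> c z) = anti_coeff \<Gamma>' c z * cnj (anti_coeff \<Gamma>' c z)"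
    using aq[OF z] aq'[OF z] by simp
  then have "(cmod (anti_coeff \<Gamma> c z))\<^sup>2 = (cmod (anti_coeff \<Gamma>' c z))\<^sup>2"
    by (metis complex_norm_square of_real_eq_iff)
  then have "cmod (anti_coeff \<Gamma> c z) = cmod (anti_coeff \<Gamma>' c z)" by simp
  then show ?thesis by (simp add: cubic_coeff_def norm_mult)
qed

text \<open>The quotient is holomorphic of constant modulus 1, so it attains its maximum modulus at
  the centre and must be constant.\<close>

lemma holomorphic_equal_norm_proportional:
  assumes hol: "f holomorphic_on ball z r" "f' holomorphic_on ball z r" and r: "r > 0"
    and eq: "\<And>w. w \<in> ball z r \<Longrightarrow> cmod (f w) = cmod (f' w)" and nz: "\<And>w. w \<in> ball z r \<Longrightarrow> f w \<noteq> 0"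
  obtains l where "cmod l = 1" "\<And>w. w \<in> ball z r \<Longrightarrow> f' w = l * f w"
proof -
  have nq: "cmod (f' w / f w) = 1" if "w \<in> ball z r" for w
    using eq[OF that] nz[OF that] by (metis norm_divide div_self norm_eq_zero)
  have "(\<lambda>w. f' w / f w) constant_on ball z r"
    using r nq nz hol
    by (intro maximum_modulus_principle[of _ _ "ball z r" z] holomorphic_on_divide) auto
  then obtain l where l: "\<And>w. w \<in> ball z r \<Longrightarrow> f' w / f w = l"
    by (auto simp: constant_on_def)
  show ?thesis
  proof (rule that)
    show "cmod l = 1" using l[of z] nq[of z] r by simp
    show "f' w = l * f w" if "w \<in> ball z r" for w
      using l[OF that] nz[OF that] by (metis nonzero_eq_divide_eq)
  qed
qed

text \<open>On a disc without zeros of the first coefficient, equal moduli give a constant ratio l.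
  The second coefficient minus l times the first vanishes there, and the identity theorem makes it
  vanish everywhere.\<close>

lemma cubic_forms_proportional:
  assumes RS: "riemann_surface S A" and sk: "special_kaehler A g \<Gamma>" and sk': "special_kaehler A g \<Gamma>'"
    and nz: "cubic_form A g \<Gamma> \<noteq> (\<lambda>c z. 0)"
  obtains l where "cmod l = 1" "cubic_form A g \<Gamma>' = (\<lambda>c z. l * cubic_form A g \<Gamma> c z)"
proof -
  note op = riemann_surface_chart(2)[OF RS]
  note hol = cubic_coeff_holomorphic[OF sk _ op] and hol' = cubic_coeff_holomorphic[OF sk' _ op]
  obtain c0 z0 where cz: "cubic_form A g \<Gamma> c0 z0 \<noteq> 0" using nz by (auto simp: fun_eq_iff)
  then have c0: "c0 \<in> A" and z0: "z0 \<in> chart_image c0"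
    by (auto simp: cubic_form_def split: if_splits)
  have "cubic_coeff g \<Gamma> c0 z0 \<noteq> 0"
    using cz cubic_form_eq[OF sk c0 op[OF c0] z0] by auto
  moreover have "isCont (cubic_coeff g \<Gamma> c0) z0"
    using hol[OF c0 c0] z0 op[OF c0] holomorphic_on_imp_continuous_on continuous_on_eq_continuous_at by blast
  ultimately obtain e where e: "e > 0" "\<And>w. dist z0 w < e \<Longrightarrow> cubic_coeff g \<Gamma> c0 w \<noteq> 0"
    using continuous_at_avoid by blast
  obtain e' where e': "e' > 0" "ball z0 e' \<subseteq> chart_image c0" using op[OF c0] z0 openE by blast
  define r where "r = min e e'"
  have r: "r > 0" "ball z0 r \<subseteq> chart_image c0" using e(1) e' by (auto simp: r_def)
  obtain l where l: "cmod l = 1" "\<And>w. w \<in> ball z0 r \<Longrightarrow> cubic_coeff g \<Gamma>' c0 w = l * cubic_coeff g \<Gamma> c0 w"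
  proof (rule holomorphic_equal_norm_proportional[OF holomorphic_on_subset[OF hol[OF c0 c0] r(2)]
        holomorphic_on_subset[OF hol'[OF c0 c0] r(2)] r(1)])
    show "cmod (cubic_coeff g \<Gamma> c0 w) = cmod (cubic_coeff g \<Gamma>' c0 w)" if "w \<in> ball z0 r" for w
      using cubic_coeff_norm_determined_by_metric[OF sk sk' c0 op[OF c0]] r(2) that by blast
    show "cubic_coeff g \<Gamma> c0 w \<noteq> 0" if "w \<in> ball z0 r" for w
      using e(2) that by (simp add: r_def)
  qed blast
  have zero: "cubic_coeff g \<Gamma>' c z - l * cubic_coeff g \<Gamma> c z = 0" if c: "c \<in> A" and z: "z \<in> chart_image c" for c z
  proof (rule riemann_surface_identity_theorem[OF RS, of "\<lambda>c z. cubic_coeff g \<Gamma>' c z - l * cubic_coeff g \<Gamma> c z",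
        OF _ _ c0 open_ball _ r(2) _ c z])
    show "(\<lambda>z. cubic_coeff g \<Gamma>' c z - l * cubic_coeff g \<Gamma> c z) holomorphic_on chart_image c" if "c \<in> A" for c
      using hol[OF that that] hol'[OF that that] by (intro holomorphic_intros)
    show "cubic_coeff g \<Gamma>' d (transition c d z) - l * cubic_coeff g \<Gamma> d (transition c d z) = 0"
      if "c \<in> A" "d \<in> A" "z \<in> overlap c d" "cubic_coeff g \<Gamma>' c z - l * cubic_coeff g \<Gamma> c z = 0" for c d z
    proof -
      \<comment> \<open>Both coefficients change by the same nonzero factor, the cube of the
        derivative, so zeros of the combination correspond across charts.\<close>
      have "(cubic_coeff g \<Gamma>' d (transition c d z) - l * cubic_coeff g \<Gamma> d (transition c d z)) * deriv (transition c d) z ^ 3 = 0"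
        using that(4) cubic_coeff_transition(2)[OF RS sk that(1-3)] cubic_coeff_transition(2)[OF RS sk' that(1-3)]
        by (simp add: algebra_simps)
      then show ?thesis using cubic_coeff_transition(1)[OF RS sk that(1-3)] by simp
    qed
  qed (use r l(2) in auto)
  have "cubic_form A g \<Gamma>' c z = l * cubic_form A g \<Gamma> c z" for c z
  proof (cases "c \<in> A \<and> z \<in> chart_image c")
    case True
    then show ?thesis
      using zero[of c z] cubic_form_eq[OF sk _ op, of c z] cubic_form_eq[OF sk' _ op, of c z] by simp
  qed (auto simp: cubic_form_def)
  with l(1) that show ?thesis by (metis ext)
qed

theorem proposition34:
  fixes S :: "'a topology" and A :: "'a chart set"
  assumes "riemann_surface S A"
  shows "(\<forall>g \<Gamma> g' \<Gamma>' \<Xi> \<Xi>'.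
            special_kaehler A g \<Gamma> \<and> special_kaehler A g' \<Gamma>' \<and>
            \<Xi> = cubic_form A g \<Gamma> \<and> \<Xi>' = cubic_form A g' \<Gamma>' \<and>
            \<Xi> \<noteq> (\<lambda>c z. 0) \<and> \<Xi>' \<noteq> (\<lambda>c z. 0) \<and> g = g' \<longrightarrow>
            (\<exists>l::complex. cmod l = 1 \<and> \<Xi>' = (\<lambda>c z. l * \<Xi> c z)))
       \<and> (\<forall>g \<Gamma> \<Xi>.
            special_kaehler A g \<Gamma> \<and> \<Xi> = cubic_form A g \<Gamma> \<and> \<Xi> \<noteq> (\<lambda>c z. 0) \<longrightarrow>
            (\<forall>l::complex. cmod l = 1 \<longrightarrow>
               (\<exists>!\<Gamma>l. special_kaehler A g \<Gamma>l \<and> cubic_form A g \<Gamma>l = (\<lambda>c z. l * \<Xi> c z))))"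
proof (intro conjI allI impI)
  fix g g' \<Gamma> \<Gamma>' \<Xi> \<Xi>'
  assume "special_kaehler A g \<Gamma> \<and> special_kaehler A g' \<Gamma>' \<and>
            \<Xi> = cubic_form A g \<Gamma> \<and> \<Xi>' = cubic_form A g' \<Gamma>' \<and>
            \<Xi> \<noteq> (\<lambda>c z. 0) \<and> \<Xi>' \<noteq> (\<lambda>c z. 0) \<and> g = g'"
  then show "\<exists>l::complex. cmod l = 1 \<and> \<Xi>' = (\<lambda>c z. l * \<Xi> c z)"
    using cubic_forms_proportional[OF assms, of g \<Gamma> \<Gamma>'] by metis
next
  fix g \<Gamma> \<Xi> and l :: complex
  assume *: "special_kaehler A g \<Gamma> \<and> \<Xi> = cubic_form A g \<Gamma> \<and> \<Xi> \<noteq> (\<lambda>c z. 0)" and l: "cmod l = 1"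
  \<comment> \<open>Rotation by \<mu> multiplies the cubic form by the square of \<mu>, so a square
    root of l is taken; it again has modulus 1.\<close>
  define \<mu> where "\<mu> = csqrt l"
  have \<mu>: "cmod \<mu> = 1" "\<mu>\<^sup>2 = l" using l by (simp_all add: \<mu>_def)
  show "\<exists>!\<Gamma>l. special_kaehler A g \<Gamma>l \<and> cubic_form A g \<Gamma>l = (\<lambda>c z. l * \<Xi> c z)"
  proof (rule ex1I)
    show "special_kaehler A g (rotate_connection \<mu> \<Gamma>) \<and>
        cubic_form A g (rotate_connection \<mu> \<Gamma>) = (\<lambda>c z. l * \<Xi> c z)"
      using * special_kaehler_rotate[OF assms _ \<mu>(1)] cubic_form_rotate[OF assms _ \<mu>(1)] \<mu>(2) by blast
    then show "\<Gamma>l = rotate_connection \<mu> \<Gamma>"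
      if "special_kaehler A g \<Gamma>l \<and> cubic_form A g \<Gamma>l = (\<lambda>c z. l * \<Xi> c z)" for \<Gamma>l
      using that special_kaehler_connection_unique[OF assms, of g \<Gamma>l "rotate_connection \<mu> \<Gamma>"] by metis
  qed
qed

end
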